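(* Let $d\ge2$, $n\ge2$, and let $G_t=(V_t,E_t)$ be a simple undirected graph with $V_t=\{1,\dots,n\}$ and $m=|E_t|$. Let $\{\mathbf{t}_i^0\}_{i\in V_t}\subseteq\mathbb{R}^d$ be locations in generic position up to the normalization $\mathrm{Tr}(T_0)=1$, $\mathrm{Tr}(HT_0)=0$ (that is, obtained from a generic point set by a common translation and scaling so that $\sum_i\|\mathbf{t}_i^0\|_2^2=1$ and $\sum_i\mathbf{t}_i^0=\mathbf{0}$), where $T_0=\mathbf{t}^0(\mathbf{t}^0)^T$ and $\mathbf{t}^0\in\mathbb{R}^{dn}$ is the vector with $i$-th $d\times 1$ block $\mathbf{t}_i^0$. Assume that the noiseless formation $\{\Gamma^0_{ij}\}_{(i,j)\in E_t}$, $\Gamma_{ij}^0=\gamma_{ij}^0(\gamma_{ij}^0)^T$, $\gamma_{ij}^0=\frac{\mathbf{t}_i^0-\mathbf{t}_j^0}{\|\mathbf{t}_i^0-\mathbf{t}_j^0\|_2}$, is parallel rigid. Let $\epsilon\ge0$ and suppose noisy measurements $\Gamma_{ij}=\gamma_{ij}\gamma_{ij}^T$, $(i,j)\in E_t$, are given with $\gamma_{ij}=\gamma^0_{ij}+\epsilon_{ij}$, $\|\epsilon_{ij}\|_2\le\epsilon$ and $\|\gamma_{ij}\|_2=1$. Let $L$ be the Laplacian built from $Q_{ij}=I_d-\Gamma_{ij}$, and let $T^*$ be a solution of $$\min_{T\in\mathbb{R}^{dn\times dn}}\ \mathrm{Tr}(LT)\quad\text{subject to}\quad \mathrm{Tr}(C^{ij}T)\ge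 1\ \ \forall (i,j)\in E_t,\quad \mathrm{Tr}(HT)=0,\quad T\succeq 0.$$ Then $$\delta(T^*,T_0)\le\epsilon\left[\alpha_1+\left(\alpha_1^2+2\alpha_2\right)^{1/2}\right],$$ where $$\alpha_1=\frac{\sqrt2\,m}{\lambda_{d+2}(L^0)},\qquad \alpha_2=\left(\frac{\kappa\sqrt d\,\|L_G\|_F}{m}+1\right)\frac{\lambda_n(L_G)}{\lambda_{d+2}(L^0)},\qquad \kappa=\Big(\min_{(i,j)\in E_t}\|\mathbf{t}^0_i-\mathbf{t}^0_j\|_2^2\Big)^{-1},$$ $L^0$ is the Laplacian built from $Q^0_{ij}=I_d-\Gamma^0_{ij}$, and $L_G$ is the graph Laplacian of $G_t$.
   Context: Matrices of size $dn\times dn$ are viewed as $n\times n$ arrays of $d\times d$ blocks; $T\succeq0$ means symmetric positive semidefinite; $\|\cdot\|_F$ is the Frobenius norm; for a symmetric $N\times N$ matrix $A$, $\lambda_1(A)\le\dots\le\lambda_N(A)$ are its eigenvalues in ascending order. Error function: $\delta(T^*,T_0)=\min_{c\ge0}\|cT^*-T_0\|_F=\Big\|\frac{\mathrm{Tr}(T^*T_0)}{\|T^*\|_F^2}T^*-T_0\Big\|_F$. Generic point set: the $dn$ coordinates are algebraically independent, i.e. no non-zero polynomial with integer coefficients vanishes at them. Laplacian: given symmetric $Q_{ij}=Q_{ji}\in\mathbb{R}^{d\times d}$ for $(i,j)\in E_t$, the associated Laplacian in $\mathbb{R}^{dn\times dn}$ has blocks $-Q_{ij}$ at $(i,j)\in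 E_t$, $\sum_{k:(i,k)\in E_t}Q_{ik}$ at $(i,i)$, and $0$ otherwise. The graph Laplacian is $L_G=D_G-A_G\in\mathbb{R}^{n\times n}$ (degree matrix minus adjacency matrix). Each undirected edge is counted once (with a fixed orientation used to define $\gamma_{ij}^0$, $\gamma_{ij}$). Constraint matrices: for $(i,j)\in E_t$, $C^{ij}\in\mathbb{R}^{dn\times dn}$ has $(i,i)$ and $(j,j)$ blocks $I_d$, $(i,j)$ and $(j,i)$ blocks $-I_d$, all other blocks $0$. $H=J_n\otimes I_d$, $J_n$ the $n\times n$ all-ones matrix. Parallel rigidity: for pairwise distinct points $\mathbf{p}_1,\dots,\mathbf{p}_n\in\mathbb{R}^d$, the formation with lines $\Gamma_{ij}=(\mathbf{p}_i-\mathbf{p}_j)(\mathbf{p}_i-\mathbf{p}_j)^T/\|\mathbf{p}_i-\mathbf{p}_j\|_2^2$, $(i,j)\in E_t$, is parallel rigid if every set of pairwise distinct points $\mathbf{q}_1,\dots,\mathbf{q}_n\in\mathbb{R}^d$ with $\mathbf{q}_i-\mathbf{q}_j$ parallel to $\mathbf{p}_i-\mathbf{p}_j$ for all $(i,j)\in E_t$ satisfies $\mathbf{q}_i=c\mathbf{p}_i+\mathbf{x}$ for all $i$, for some $c\in\mathbb{R}\setminus\{0\}$, $\mathbf{x}\in\mathbb{R}^d$. Equivalently, the linear system $(I_d-\Gamma_{ij})(\mathbf{q}_i-\mathbf{q}_j)=0$, $(i,j)\in E_t$, in $\mathbf{q}\in\mathbb{R}^{dn}$ has a solution space of dimension exactly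 $d+1$. *)

theory Defs
  imports "HOL-Analysis.Analysis" "HOL-Computational_Algebra.Polynomial" "HOL-Library.Poly_Mapping"
begin

text \<open>
  The vertex set is the finite type \<open>'n\<close> and the ambient space is \<open>real^'d\<close>. Vectors and matrices
  of size \<open>dn\<close> are indexed by \<open>'n \<times> 'd\<close>: the pair \<open>(i, a)\<close> is the \<open>a\<close>-th coordinate of the
  \<open>i\<close>-th block. Undirected edges are two-element sets. On matrices, \<^const>\<open>norm\<close> is the
  Euclidean norm of the vector of all entries, that is, the Frobenius norm.
\<close>

definition block_matrix :: "('n::finite \<Rightarrow> 'n \<Rightarrow> real^'d::finite^'d) \<Rightarrow> real^('n \<times> 'd)^('n \<times> 'd)" where
  "block_matrix B = (\<chi> p q. B (fst p) (fst q) $ snd p $ snd q)"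

definition stack :: "('n::finite \<Rightarrow> real^'d::finite) \<Rightarrow> real^('n \<times> 'd)" where
  "stack t = (\<chi> p. t (fst p) $ snd p)"

definition kronecker :: "real^'n::finite^'n \<Rightarrow> real^'d::finite^'d \<Rightarrow> real^('n \<times> 'd)^('n \<times> 'd)" where
  "kronecker A B = (\<chi> p q. A $ fst p $ fst q * B $ snd p $ snd q)"

definition outer :: "real^'k::finite \<Rightarrow> real^'k \<Rightarrow> real^'k^'k" where
  "outer u v = (\<chi> a b. u $ a * v $ b)"

definition psd :: "real^'k::finite^'k \<Rightarrow> bool" where
  "psd A \<longleftrightarrow> transpose A = A \<and> (\<forall>x. 0 \<le> x \<bullet> (A *v x))"

definition charpoly :: "real^'k::finite^'k \<Rightarrow> real poly" where
  "charpoly A = det (\<chi> i j. (if i = j then [:0, 1:] else 0) - [:A $ i $ j:])"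

text \<open>
  \<open>eigenvalue k A\<close> is the \<open>k\<close>-th smallest real eigenvalue, counted with multiplicity, where
  \<open>k\<close> starts at 1. If \<open>A\<close> is symmetric, all roots of its characteristic polynomial are real, so
  the list has full length and every index from 1 to the size of \<open>A\<close> is meaningful.
\<close>

definition eigenvalue :: "nat \<Rightarrow> real^'k::finite^'k \<Rightarrow> real" where
  "eigenvalue k A = sorted_list_of_multiset (proots (charpoly A)) ! (k - 1)"

definition simple_graph :: "'n::finite set set \<Rightarrow> bool" where
  "simple_graph E \<longleftrightarrow> (\<forall>e\<in>E. card e = 2)"

definition orientation :: "('n::finite \<times> 'n) set \<Rightarrow> 'n set set \<Rightarrow> bool" where
  "orientation A E \<longleftrightarrow> bij_betw (\<lambda>(i, j). {i, j}) A E"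

definition adjacency_matrix :: "'n::finite set set \<Rightarrow> real^'n^'n" where
  "adjacency_matrix E = (\<chi> i j. if {i, j} \<in> E then 1 else 0)"

definition degree_matrix :: "'n::finite set set \<Rightarrow> real^'n^'n" where
  "degree_matrix E = (\<chi> i j. if i = j then real (card {k. {i, k} \<in> E}) else 0)"

definition graph_laplacian :: "'n::finite set set \<Rightarrow> real^'n^'n" where
  "graph_laplacian E = degree_matrix E - adjacency_matrix E"

definition laplacian ::
  "'n::finite set set \<Rightarrow> ('n \<Rightarrow> 'n \<Rightarrow> real^'d::finite^'d) \<Rightarrow> real^('n \<times> 'd)^('n \<times> 'd)" where
  "laplacian E Q = block_matrix (\<lambda>i j.
     if i = j then (\<Sum>k | {i, k} \<in> E. Q i k)
     else if {i, j} \<in> E then - Q i j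
     else 0)"

definition C_matrix :: "'n::finite \<Rightarrow> 'n \<Rightarrow> real^('n \<times> 'd::finite)^('n \<times> 'd)" where
  "C_matrix i j = block_matrix (\<lambda>k l.
     if k = l \<and> (k = i \<or> k = j) then mat 1
     else if (k = i \<and> l = j) \<or> (k = j \<and> l = i) then - mat 1
     else 0)"

definition H_matrix :: "real^('n::finite \<times> 'd::finite)^('n \<times> 'd)" where
  "H_matrix = kronecker (\<chi> i j. 1) (mat 1)"

definition feasible :: "'n::finite set set \<Rightarrow> real^('n \<times> 'd::finite)^('n \<times> 'd) \<Rightarrow> bool" where
  "feasible E T \<longleftrightarrow>
     (\<forall>i j. {i, j} \<in> E \<longrightarrow> trace (C_matrix i j ** T) \<ge> 1) \<and>
     trace (H_matrix ** T) = 0 \<and> psd T"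

definition sdp_solution ::
  "'n::finite set set \<Rightarrow> real^('n \<times> 'd::finite)^('n \<times> 'd) \<Rightarrow> real^('n \<times> 'd)^('n \<times> 'd) \<Rightarrow> bool" where
  "sdp_solution E L T \<longleftrightarrow> is_arg_min (\<lambda>T. trace (L ** T)) (feasible E) T"

text \<open>The infimum is attained, since it is the distance of \<open>T\<^sub>0\<close> to a closed half-line.\<close>

definition err :: "real^'k::finite^'k \<Rightarrow> real^'k^'k \<Rightarrow> real" where
  "err T T\<^sub>0 = (INF c\<in>{0..}. norm (c *\<^sub>R T - T\<^sub>0))"

text \<open>
  Polynomials with integer coefficients in variables indexed by \<open>'v\<close>: a finitely supported map
  from monomials (finitely supported exponent vectors) to coefficients.
\<close>

type_synonym 'v int_mpoly = "('v \<Rightarrow>\<^sub>0 nat) \<Rightarrow>\<^sub>0 int"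

definition eval_int_mpoly :: "'v int_mpoly \<Rightarrow> ('v \<Rightarrow> real) \<Rightarrow> real" where
  "eval_int_mpoly P x =
     (\<Sum>m\<in>Poly_Mapping.keys P. of_int (Poly_Mapping.lookup P m) *
        (\<Prod>v\<in>Poly_Mapping.keys m. x v ^ Poly_Mapping.lookup m v))"

definition generic :: "('n::finite \<Rightarrow> real^'d::finite) \<Rightarrow> bool" where
  "generic p \<longleftrightarrow> (\<forall>P :: ('n \<times> 'd) int_mpoly. P \<noteq> 0 \<longrightarrow> eval_int_mpoly P (\<lambda>(i, a). p i $ a) \<noteq> 0)"

definition generic_up_to_normalization :: "('n::finite \<Rightarrow> real^'d::finite) \<Rightarrow> bool" where
  "generic_up_to_normalization t \<longleftrightarrow>
     (\<exists>p c x. generic p \<and> c \<noteq> 0 \<and> (\<forall>i. t i = c *\<^sub>R p i + x))"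

definition unit_dir :: "('n::finite \<Rightarrow> real^'d::finite) \<Rightarrow> 'n \<Rightarrow> 'n \<Rightarrow> real^'d" where
  "unit_dir t i j = (t i - t j) /\<^sub>R norm (t i - t j)"

text \<open>
  For the lines spanned by the differences of the points \<open>p\<close>. Since \<open>q\<close> and \<open>p\<close> are injective, the
  differences along edges are nonzero and the factor \<open>s\<close> is necessarily nonzero (of either sign).
\<close>

definition parallel_rigid :: "'n::finite set set \<Rightarrow> ('n \<Rightarrow> real^'d::finite) \<Rightarrow> bool" where
  "parallel_rigid E p \<longleftrightarrow> inj p \<and>
     (\<forall>q :: 'n \<Rightarrow> real^'d.
        inj q \<and> (\<forall>i j. {i, j} \<in> E \<longrightarrow> (\<exists>s. q i - q j = s *\<^sub>R (p i - p j)))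
        \<longrightarrow> (\<exists>c x. c \<noteq> 0 \<and> (\<forall>i. q i = c *\<^sub>R p i + x)))"

end

(* The optimum is written as a sum of rank-one terms x_k x_k^T, so that every trace becomes a sum
   of quadratic forms. On vectors with block sum 0 the form of L_0 is at least
   lambda_{d+2}(L_0) times the squared distance to the line of the true locations, because by
   rigidity the null space of L_0 is spanned by them and the d translations. The distance of a
   vector to a line changes by at most epsilon times its norm when the line is perturbed, so by
   Minkowski's inequality the square root of Tr(L_0 T) is at most that of Tr(L T) plus epsilon
   times the root of the total edge energy of T, and Tr(L T) is bounded by comparing T with the
   feasible point kappa T_0. The resulting constant sqrt(2 g / l) (1 + sqrt K'), with
   g = lambda_n(L_G), l = lambda_{d+2}(L_0) and K' = kappa g / m, is below the stated one because
   l <= g <= 2 m. *)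

theory Submission
  imports Defs
begin

section \<open>Spectral theory of symmetric matrices\<close>

text \<open>The optimum T may have any rank and its scale is not fixed, so it is compared with
  \<open>T\<^sub>0\<close> after division by its trace. The squared error is then at most 2 / Tr T
  times the total squared distance of the x_k to the line of the true locations, which is what the
  spectral gap controls. Tr T needs only a lower bound, and adding the m edge constraints gives m <=
  g Tr T. With it the value at \<kappa> \<open>T\<^sub>0\<close>, at most \<epsilon>^2 \<kappa> g,
  is bounded by K' \<epsilon>^2 g Tr T, in the same unit as the perturbation term, so that Tr T
  cancels at the end. Estimating roots of energies instead of energies keeps the bound linear in
  \<epsilon>. One obstacle is that rigidity speaks of injective configurations only, while a null
  space also contains degenerate ones; adding a suitable multiple of a null vector to the true
  locations keeps them distinct. The slack that makes the stated constant large enough comes from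
  sqrt d >= sqrt 2.\<close>

lemma selfadjoint_eigenbasis:
  fixes f :: "'a::euclidean_space \<Rightarrow> 'a"
  assumes f: "linear f" and sa: "\<And>x y. f x \<bullet> y = x \<bullet> f y"
    and "subspace S" and "\<And>x. x \<in> S \<Longrightarrow> f x \<in> S"
  shows "\<exists>B\<subseteq>S. pairwise orthogonal B \<and> (\<forall>b\<in>B. norm b = 1 \<and> (\<exists>\<mu>. f b = \<mu> *\<^sub>R b)) \<and> span B = S"
  using assms(3,4)
proof (induction "dim S" arbitrary: S rule: less_induct)
  case less
  show ?case
  proof (cases "S \<subseteq> {0}")
    case True
    then have "S = {0}" using less.prems(1) subspace_0 by blast
    then show ?thesis by (intro exI[of _ "{}"]) (auto simp: pairwise_def)
  next
    case False
    then obtain x0 where x0: "x0 \<in> S" "x0 \<noteq> 0" by auto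
    \<comment> \<open>A maximiser of the Rayleigh quotient on the unit sphere of \<open>S\<close>
      exists by compactness and will be the first eigenvector.\<close>
    let ?K = "S \<inter> sphere 0 1"
    have "x0 /\<^sub>R norm x0 \<in> ?K" using x0 less.prems(1) by (auto simp: subspace_scale)
    then have ne: "?K \<noteq> {}" by blast
    have comp: "compact ?K"
      using closed_Int_compact[OF closed_subspace[OF less.prems(1)] compact_sphere] by blast
    have cont: "continuous_on ?K (\<lambda>x. x \<bullet> f x)"
      by (intro continuous_intros linear_continuous_on) (simp add: f linear_conv_bounded_linear[symmetric])
    from continuous_attains_sup[OF comp ne cont] obtain v
      where v: "v \<in> ?K" and vmax: "\<And>y. y \<in> ?K \<Longrightarrow> y \<bullet> f y \<le> v \<bullet> f v" by blast
    define \<mu> where "\<mu> = v \<bullet> f v"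
    have vS: "v \<in> S" and vn: "norm v = 1" and vv: "v \<bullet> v = 1"
      using v by (auto simp: norm_eq_1)
    have max: "y \<bullet> f y \<le> \<mu> * (y \<bullet> y)" if "y \<in> S" for y
    proof (cases "y = 0")
      case True
      then show ?thesis by simp
    next
      case False
      have "y /\<^sub>R norm y \<in> ?K" using that False less.prems(1) by (auto simp: subspace_scale)
      from vmax[OF this] have "(y \<bullet> f y) / (norm y)\<^sup>2 \<le> \<mu>"
        using f by (simp add: linear_scale \<mu>_def power2_eq_square divide_inverse mult_ac)
      then show ?thesis using False by (simp add: power2_norm_eq_inner[symmetric] field_simps)
    qed
    \<comment> \<open>Up to sign, \<open>w\<close> is the derivative of the quotient at
      \<open>v\<close>. If it were nonzero, a small step from \<open>v\<close> against
      \<open>w\<close> would exceed the maximum.\<close>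
    define w where "w = \<mu> *\<^sub>R v - f v"
    have wS: "w \<in> S" unfolding w_def
      by (intro subspace_diff subspace_scale less.prems vS)
    have vw: "v \<bullet> w = 0" by (simp add: w_def inner_diff_right vv \<mu>_def)
    have "w = 0"
    proof (rule ccontr)
      assume "w \<noteq> 0"
      then have ww: "w \<bullet> w > 0" by simp
      define b where "b = \<mu> * (w \<bullet> w) - w \<bullet> f w"
      have q: "2 * s * (w \<bullet> w) + s\<^sup>2 * b \<ge> 0" for s :: real
      proof -
        have "v + s *\<^sub>R w \<in> S" by (intro subspace_add subspace_scale less.prems vS wS)
        from max[OF this] have "(v + s *\<^sub>R w) \<bullet> f (v + s *\<^sub>R w) \<le> \<mu> * ((v + s *\<^sub>R w) \<bullet> (v + s *\<^sub>R w))" .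
        moreover have "v \<bullet> f w = - (w \<bullet> w)" "w \<bullet> f v = - (w \<bullet> w)"
        proof -
          show "w \<bullet> f v = - (w \<bullet> w)"
            using vw by (simp add: w_def inner_diff_right inner_diff_left inner_commute)
          then show "v \<bullet> f w = - (w \<bullet> w)" by (metis sa inner_commute)
        qed
        ultimately show ?thesis
          using f vv vw
          by (simp add: linear_add linear_scale inner_add_left inner_add_right inner_commute[of w v]
              b_def \<mu>_def[symmetric] algebra_simps power2_eq_square)
      qed
      \<comment> \<open>Small enough that the quadratic term cancels at most half of the linear one;
        the summand 1 covers \<open>b = 0\<close>.\<close>
      define s where "s = - (w \<bullet> w) / (\<bar>b\<bar> + 1)"
      have "s\<^sup>2 * b \<le> s\<^sup>2 * (\<bar>b\<bar> + 1)" by (intro mult_left_mono) auto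
      also have "\<dots> = - s * (w \<bullet> w)" by (simp add: s_def power2_eq_square)
      finally have "s * (w \<bullet> w) \<ge> 0" using q[of s] by simp
      moreover have "s < 0" using ww by (simp add: s_def field_simps)
      ultimately show False using ww by (simp add: zero_le_mult_iff)
    qed
    then have fv: "f v = \<mu> *\<^sub>R v" by (simp add: w_def)
    \<comment> \<open>The complement of an eigenvector is invariant because \<open>f\<close> is
      self-adjoint, so the induction continues there.\<close>
    define S' where "S' = {x \<in> S. v \<bullet> x = 0}"
    have subS': "subspace S'"
      using less.prems(1) by (auto simp: S'_def subspace_def inner_add_right)
    have "v \<notin> S'" by (simp add: S'_def vv)
    then have "S' \<subset> S" using vS unfolding S'_def by blast
    then have dimS': "dim S' < dim S"
      using subS' less.prems(1) by (metis dim_psubset span_eq_iff)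
    have invS': "f x \<in> S'" if "x \<in> S'" for x
      using that less.prems(2) fv by (auto simp: S'_def sa[symmetric])
    from less.hyps[OF dimS' subS' invS'] obtain B where
      B: "B \<subseteq> S'" "pairwise orthogonal B" "\<forall>b\<in>B. norm b = 1 \<and> (\<exists>\<mu>. f b = \<mu> *\<^sub>R b)" "span B = S'"
      by blast
    show ?thesis
    proof (intro exI[of _ "insert v B"] conjI)
      show "insert v B \<subseteq> S" using B(1) vS by (auto simp: S'_def)
      show "pairwise orthogonal (insert v B)"
        using B(1,2) by (auto simp: pairwise_insert orthogonal_def S'_def inner_commute)
      show "\<forall>b\<in>insert v B. norm b = 1 \<and> (\<exists>\<mu>. f b = \<mu> *\<^sub>R b)" using B(3) fv vn by auto
      show "span (insert v B) = S"
      proof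
        show "span (insert v B) \<subseteq> S"
          using B(1) vS less.prems(1) by (intro span_minimal) (auto simp: S'_def)
        show "S \<subseteq> span (insert v B)"
        proof
          fix x assume "x \<in> S"
          then have "x - (v \<bullet> x) *\<^sub>R v \<in> S'"
            using less.prems(1) vS by (auto simp: S'_def subspace_diff subspace_scale inner_diff_right vv)
          then show "x \<in> span (insert v B)" using B(4) by (auto simp: span_breakdown_eq)
        qed
      qed
    qed
  qed
qed

text \<open>Indexing by the coordinate type makes the orthonormal family a basis. The values carry
  multiplicity but no order.\<close>

definition eigensystem :: "real^'k::finite^'k \<Rightarrow> ('k \<Rightarrow> real^'k) \<Rightarrow> ('k \<Rightarrow> real) \<Rightarrow> bool" where
  "eigensystem A v \<mu> \<longleftrightarrow>
     (\<forall>i j. v i \<bullet> v j = (if i = j then 1 else 0)) \<and> (\<forall>i. A *v v i = \<mu> i *\<^sub>R v i)"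

lemma eigensystem_exists:
  fixes A :: "real^'k::finite^'k"
  assumes "transpose A = A"
  obtains v \<mu> where "eigensystem A v \<mu>"
proof -
  have sa: "(A *v x) \<bullet> y = x \<bullet> (A *v y)" for x y
    by (metis assms dot_lmul_matrix inner_commute transpose_matrix_vector)
  obtain B where B: "pairwise orthogonal B" "\<forall>b\<in>B. norm b = 1 \<and> (\<exists>\<mu>. A *v b = \<mu> *\<^sub>R b)"
    "span B = (UNIV :: (real^'k) set)"
    using selfadjoint_eigenbasis[of "(*v) A" UNIV] sa by auto
  have "0 \<notin> B" using B(2) by force
  then have ind: "independent B" using B(1) pairwise_orthogonal_independent by blast
  have "card B = CARD('k)"
    using dim_span_eq_card_independent[OF ind] B(3) by simp
  moreover have "finite B" using ind finiteI_independent by blast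
  ultimately obtain v where v: "bij_betw v (UNIV :: 'k set) B"
    by (metis finite finite_same_card_bij)
  have vB: "v i \<in> B" for i using v bij_betwE by blast
  have vi: "v i \<bullet> v j = (if i = j then 1 else 0)" for i j
  proof (cases "i = j")
    case True
    then show ?thesis using B(2) vB by (simp add: norm_eq_1)
  next
    case False
    then have "v i \<noteq> v j" using v by (auto simp: bij_betw_def inj_on_def)
    then show ?thesis using False B(1) vB by (auto simp: pairwise_def orthogonal_def)
  qed
  have "\<exists>\<mu>. A *v v i = \<mu> *\<^sub>R v i" for i using B(2) vB by blast
  then obtain \<mu> where "\<And>i. A *v v i = \<mu> i *\<^sub>R v i" by metis
  with vi show ?thesis by (intro that) (auto simp: eigensystem_def)
qed

lemma eigensystem_orthogonal_matrix:
  assumes "eigensystem A v \<mu>"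
  shows "orthogonal_matrix (\<chi> i j. v j $ i)"
proof -
  have "transpose (\<chi> i j. v j $ i) ** (\<chi> i j. v j $ i) = mat 1"
    using assms by (simp add: eigensystem_def vec_eq_iff matrix_matrix_mult_def transpose_def mat_def inner_vec_def)
  then show ?thesis by (simp add: orthogonal_matrix)
qed

text \<open>The matrix with columns \<open>v j\<close> is square, so its left inverse, the
  transpose, is also a right inverse; this is completeness.\<close>

lemma eigensystem_expand:
  assumes "eigensystem A v \<mu>"
  shows "x = (\<Sum>i\<in>UNIV. (v i \<bullet> x) *\<^sub>R v i)"
proof -
  have "(\<chi> i j. v j $ i) ** transpose (\<chi> i j. v j $ i) = mat 1"
    using eigensystem_orthogonal_matrix[OF assms] by (simp add: orthogonal_matrix_def)
  then have "x = (\<chi> i j. v j $ i) *v (transpose (\<chi> i j. v j $ i) *v x)"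
    by (metis matrix_vector_mul_assoc matrix_vector_mul_lid)
  also have "\<dots> = (\<Sum>i\<in>UNIV. (v i \<bullet> x) *\<^sub>R v i)"
    by (simp add: vec_eq_iff matrix_vector_mult_def transpose_def inner_vec_def mult.commute)
  finally show ?thesis .
qed

lemma eigensystem_inner:
  assumes "eigensystem A v \<mu>"
  shows "x \<bullet> y = (\<Sum>i\<in>UNIV. (v i \<bullet> x) * (v i \<bullet> y))"
proof -
  have "x \<bullet> y = (\<Sum>i\<in>UNIV. (v i \<bullet> x) *\<^sub>R v i) \<bullet> y"
    using eigensystem_expand[OF assms, of x] by (rule arg_cong)
  also have "\<dots> = (\<Sum>i\<in>UNIV. (v i \<bullet> x) * (v i \<bullet> y))"
    by (simp only: inner_sum_left inner_scaleR_left)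
  finally show ?thesis .
qed

lemma eigensystem_symmetric:
  assumes "eigensystem A v \<mu>"
  shows "v i \<bullet> (A *v x) = \<mu> i * (v i \<bullet> x)"
proof -
  have "A *v x = (\<Sum>j\<in>UNIV. (v j \<bullet> x * \<mu> j) *\<^sub>R v j)"
    by (subst eigensystem_expand[OF assms, of x])
       (use assms in \<open>simp add: eigensystem_def linear_sum[OF matrix_vector_mul_linear] matrix_vector_mult_scaleR\<close>)
  moreover have "v i \<bullet> v j = (if i = j then 1 else 0)" for j
    using assms unfolding eigensystem_def by blast
  ultimately show ?thesis
    by (simp only: inner_sum_right inner_scaleR_right) (simp add: if_distrib mult.commute cong: if_cong)
qed

lemma eigensystem_quadratic:
  assumes "eigensystem A v \<mu>"
  shows "x \<bullet> (A *v x) = (\<Sum>i\<in>UNIV. \<mu> i * (v i \<bullet> x)\<^sup>2)"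
proof -
  have "x \<bullet> (A *v x) = (\<Sum>i\<in>UNIV. (v i \<bullet> x) * (v i \<bullet> (A *v x)))"
    by (rule eigensystem_inner[OF assms])
  also have "\<dots> = (\<Sum>i\<in>UNIV. \<mu> i * (v i \<bullet> x)\<^sup>2)"
    by (simp only: eigensystem_symmetric[OF assms] power2_eq_square mult_ac)
  finally show ?thesis .
qed

text \<open>Diagonalisation over the polynomial ring: (X - A) P = P (X - D) with P the constant
  matrix of eigenvectors. The square of det P is 1, so det P can be cancelled.\<close>

lemma eigensystem_charpoly:
  fixes A :: "real^'k::finite^'k"
  assumes "eigensystem A v \<mu>"
  shows "charpoly A = (\<Prod>i\<in>UNIV. [:- \<mu> i, 1:])"
proof -
  let ?M = "(\<chi> i j. (if i = j then [:0, 1:] else 0) - [:A $ i $ j:]) :: real poly^'k^'k"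
  let ?P = "(\<chi> i j. [:v j $ i:]) :: real poly^'k^'k"
  let ?D = "(\<chi> i j. if i = j then [:- \<mu> i, 1:] else 0) :: real poly^'k^'k"
  have sum_const: "(\<Sum>k\<in>S. [:f k:]) = [:\<Sum>k\<in>S. f k:]" for f :: "'k \<Rightarrow> real" and S
    by (induction S rule: infinite_finite_induct) auto
  have "transpose ?P ** ?P = mat 1"
    using assms
    by (simp add: eigensystem_def vec_eq_iff matrix_matrix_mult_def transpose_def mat_def
        inner_vec_def sum_const one_pCons)
  then have "det (transpose ?P ** ?P) = det (mat 1 :: real poly^'k^'k)" by (rule arg_cong)
  then have "det ?P * det ?P = 1" by (simp only: det_mul det_transpose det_I)
  then have P: "det ?P \<noteq> 0" by auto
  have "A *v v j = \<mu> j *\<^sub>R v j" for j using assms by (simp add: eigensystem_def)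
  then have Av: "(\<Sum>k\<in>UNIV. v j $ k * A $ i $ k) = \<mu> j * v j $ i" for i j
    by (simp add: vec_eq_iff matrix_vector_mult_def mult.commute)
  have "(?M ** ?P) $ i $ j = (?P ** ?D) $ i $ j" for i j
  proof -
    have "(?M ** ?P) $ i $ j = [:0, 1:] * [:v j $ i:] - (\<Sum>k\<in>UNIV. [:v j $ k * A $ i $ k:])"
      by (simp add: matrix_matrix_mult_def left_diff_distrib sum_subtractf if_distrib[of "\<lambda>x. x * _"]
          cong: if_cong del: mult_pCons_left mult_pCons_right) (simp add: mult.commute)
    also have "\<dots> = [:v j $ i:] * [:- \<mu> j, 1:]"
      by (simp add: sum_const Av mult.commute)
    also have "\<dots> = (?P ** ?D) $ i $ j"
      by (simp add: matrix_matrix_mult_def if_distrib[of "\<lambda>x. _ * x"]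
          cong: if_cong del: mult_pCons_left mult_pCons_right)
    finally show ?thesis .
  qed
  then have "?M ** ?P = ?P ** ?D" by (simp add: vec_eq_iff)
  then have "det (?M ** ?P) = det (?P ** ?D)" by (rule arg_cong)
  then have "det ?M * det ?P = det ?D * det ?P" by (simp only: det_mul mult.commute)
  then have "det ?M = det ?D" using P by simp
  also have "det ?D = (\<Prod>i\<in>UNIV. [:- \<mu> i, 1:])" by (subst det_diagonal) auto
  finally show ?thesis by (simp add: charpoly_def)
qed

section \<open>Position of an eigenvalue in the ascending order\<close>

lemma eigenvalue_eigensystem:
  fixes A :: "real^'k::finite^'k"
  assumes "eigensystem A v \<mu>"
  shows "eigenvalue k A = sorted_list_of_multiset (image_mset \<mu> (mset_set UNIV)) ! (k - 1)"
proof -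
  have "proots (\<Prod>i\<in>S. [:- \<mu> i, 1:]) = image_mset \<mu> (mset_set S)" if "finite S" for S :: "'k set"
    using that
  proof (induction S rule: finite_induct)
    case (insert x S)
    have "(\<Prod>i\<in>S. [:- \<mu> i, 1:]) \<noteq> 0" using insert(1) by (simp add: prod_zero_iff)
    moreover have "proots [:- \<mu> x, 1:] = {#\<mu> x#}"
      using proots_linear_factor[of "\<mu> x"] by simp
    ultimately show ?case
      using insert by (simp add: proots_mult del: mult_pCons_left)
  qed simp
  then show ?thesis by (simp add: eigenvalue_def eigensystem_charpoly[OF assms])
qed

lemma eigenvalue_attained:
  fixes A :: "real^'k::finite^'k"
  assumes "eigensystem A v \<mu>" "1 \<le> k" "k \<le> CARD('k)"
  obtains i where "eigenvalue k A = \<mu> i"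
proof -
  let ?xs = "sorted_list_of_multiset (image_mset \<mu> (mset_set UNIV))"
  have "length ?xs = CARD('k)"
    by (metis mset_sorted_list_of_multiset size_image_mset size_mset size_mset_set)
  then have "?xs ! (k - 1) \<in> set ?xs" using assms(2,3) by (intro nth_mem) auto
  then show ?thesis using that by (auto simp: eigenvalue_eigensystem[OF assms(1)])
qed

lemma eigenvalue_top:
  fixes A :: "real^'k::finite^'k"
  assumes "eigensystem A v \<mu>"
  shows "\<mu> i \<le> eigenvalue CARD('k) A"
proof -
  let ?xs = "sorted_list_of_multiset (image_mset \<mu> (mset_set UNIV))"
  have len: "length ?xs = CARD('k)"
    by (metis mset_sorted_list_of_multiset size_image_mset size_mset size_mset_set)
  have "\<mu> i \<in> set ?xs" by simp
  then obtain j where "j < length ?xs" "?xs ! j = \<mu> i" by (metis in_set_conv_nth)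
  moreover have "sorted ?xs" by (rule sorted_sorted_list_of_multiset)
  then have "?xs ! j \<le> ?xs ! (CARD('k) - 1)"
    using \<open>j < length ?xs\<close> len by (intro sorted_nth_mono) linarith+
  ultimately show ?thesis
    by (simp only: eigenvalue_eigensystem[OF assms])
qed

text \<open>The \<open>r\<close> zeros fill the list positions 0 to r - 1, so position
  \<open>r\<close>, which is what \<open>eigenvalue (Suc r)\<close> reads, holds the smallest
  positive value.\<close>

lemma eigenvalue_first_positive:
  fixes A :: "real^'k::finite^'k"
  assumes es: "eigensystem A v \<mu>" and nn: "\<And>i. 0 \<le> \<mu> i"
    and r: "card {i. \<mu> i = 0} = r" "r < CARD('k)"
  shows "0 < eigenvalue (Suc r) A" and "\<mu> i \<noteq> 0 \<Longrightarrow> eigenvalue (Suc r) A \<le> \<mu> i"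
proof -
  let ?xs = "sorted_list_of_multiset (image_mset \<mu> (mset_set UNIV))"
  have len: "length ?xs = CARD('k)"
    by (metis mset_sorted_list_of_multiset size_image_mset size_mset size_mset_set)
  have srt: "sorted ?xs" by simp
  have ev: "eigenvalue (Suc r) A = ?xs ! r" by (simp add: eigenvalue_eigensystem[OF es])
  let ?J = "{j. j < length ?xs \<and> ?xs ! j \<le> 0}"
  have "card ?J = length (filter (\<lambda>x. x \<le> 0) ?xs)" by (simp add: length_filter_conv_card)
  also have "\<dots> = size (filter_mset (\<lambda>x. x \<le> 0) (mset ?xs))"
    by (metis mset_filter size_mset)
  also have "\<dots> = card {i. \<mu> i \<le> 0}"
    by (simp add: filter_mset_image_mset filter_mset_mset_set)
  also have "{i. \<mu> i \<le> 0} = {i. \<mu> i = 0}" using nn by (auto intro: order.antisym)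
  also have "card \<dots> = r" by (rule r(1))
  finally have J: "card ?J = r" .
  show "0 < eigenvalue (Suc r) A"
  proof (rule ccontr)
    assume "\<not> ?thesis"
    then have "?xs ! j \<le> 0" if "j \<le> r" for j
      using ev r(2) len that sorted_nth_mono[OF srt, of j r] by linarith
    then have "{..r} \<subseteq> ?J" using r(2) len by auto
    then have "card {..r} \<le> card ?J" by (intro card_mono) auto
    then show False using J by simp
  qed
  show "eigenvalue (Suc r) A \<le> \<mu> i" if "\<mu> i \<noteq> 0"
  proof (rule ccontr)
    assume "\<not> ?thesis"
    then have lt: "\<mu> i < ?xs ! r" using ev by simp
    have "\<mu> i \<in> set ?xs" by simp
    then obtain j where j: "j < length ?xs" "?xs ! j = \<mu> i" by (metis in_set_conv_nth)
    have "j < r" using lt j sorted_nth_mono[OF srt, of r j] by linarith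
    have "?J \<subseteq> {..<j}"
    proof
      fix l assume l: "l \<in> ?J"
      have "0 < ?xs ! j" using j nn[of i] that by linarith
      moreover have "?xs ! l \<le> 0" "l < length ?xs" using l by auto
      ultimately have "l < j" using sorted_nth_mono[OF srt, of j l] by linarith
      then show "l \<in> {..<j}" by simp
    qed
    then have "card ?J \<le> j" using card_mono[of "{..<j}" ?J] by simp
    then show False using J \<open>j < r\<close> by simp
  qed
qed

section \<open>Positive semidefinite matrices and block Laplacians\<close>

lemma sum_matrix_vector_mult:
  "(\<Sum>k\<in>S. M k) *v x = (\<Sum>k\<in>S. M k *v x)" for M :: "'b \<Rightarrow> real^'k::finite^'m::finite"
  by (induction S rule: infinite_finite_induct) (simp_all add: matrix_vector_mult_add_rdistrib)

lemma trace_sum: "trace (\<Sum>k\<in>S. M k) = (\<Sum>k\<in>S. trace (M k))" for M :: "'b \<Rightarrow> real^'k::finite^'k"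
  by (induction S rule: infinite_finite_induct) (simp_all add: trace_def sum.distrib)

lemma matrix_mult_sum_right:
  "A ** (\<Sum>k\<in>S. M k) = (\<Sum>k\<in>S. A ** M k)" for M :: "'b \<Rightarrow> real^'k::finite^'k"
  by (induction S rule: infinite_finite_induct) (simp_all add: matrix_add_ldistrib)

lemma outer_mult_vector: "outer u w *v x = (w \<bullet> x) *\<^sub>R u"
  by (simp add: outer_def vec_eq_iff matrix_vector_mult_def inner_vec_def sum_distrib_left mult_ac)

lemma trace_outer: "trace (outer u u) = u \<bullet> u"
  by (simp add: trace_def outer_def inner_vec_def)

lemma trace_mult_outer: "trace (M ** outer u u) = u \<bullet> (M *v u)"
  by (simp add: trace_def outer_def inner_vec_def matrix_matrix_mult_def matrix_vector_mult_def
      sum_distrib_left mult_ac)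

lemma transpose_outer: "transpose (outer u u) = outer u u"
  by (simp add: transpose_def outer_def mult.commute)

lemma psd_scaleR_outer: "c \<ge> 0 \<Longrightarrow> psd (c *\<^sub>R outer u u)"
  by (simp add: psd_def transpose_scalar transpose_outer outer_mult_vector inner_commute
      scaleR_matrix_vector_assoc[symmetric] scalar_matrix_assoc mult.assoc)

text \<open>Eigenvalues of a positive semidefinite matrix have square roots, which are absorbed into
  the eigenvectors of the spectral decomposition.\<close>

lemma psd_sum_outer:
  fixes T :: "real^'k::finite^'k"
  assumes "psd T"
  obtains x :: "'k \<Rightarrow> real^'k" where "T = (\<Sum>k\<in>UNIV. outer (x k) (x k))"
proof -
  obtain v \<mu> where es: "eigensystem T v \<mu>" using assms eigensystem_exists unfolding psd_def by blast
  have \<mu>: "0 \<le> \<mu> k" for k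
  proof -
    have "0 \<le> v k \<bullet> (T *v v k)" using assms by (simp add: psd_def)
    also have "v k \<bullet> (T *v v k) = \<mu> k"
      using es by (simp add: eigensystem_symmetric[OF es]) (simp add: eigensystem_def)
    finally show ?thesis .
  qed
  define x where "x k = sqrt (\<mu> k) *\<^sub>R v k" for k
  have "T *v y = (\<Sum>k\<in>UNIV. outer (x k) (x k)) *v y" for y
  proof -
    have "T *v y = (\<Sum>k\<in>UNIV. (v k \<bullet> (T *v y)) *\<^sub>R v k)" by (rule eigensystem_expand[OF es])
    also have "\<dots> = (\<Sum>k\<in>UNIV. outer (x k) (x k) *v y)"
      by (simp add: eigensystem_symmetric[OF es] outer_mult_vector x_def mult_ac
          mult.assoc[symmetric] real_sqrt_mult_self \<mu>)
    finally show ?thesis by (simp only: sum_matrix_vector_mult)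
  qed
  then have "T = (\<Sum>k\<in>UNIV. outer (x k) (x k))" by (simp add: matrix_eq)
  then show ?thesis by (rule that)
qed

lemma norm_matrix_vector_le:
  fixes M :: "real^'k::finite^'m::finite"
  shows "norm (M *v x) \<le> norm M * norm x"
proof -
  have "norm (M *v x) = L2_set (\<lambda>i. \<bar>M $ i \<bullet> x\<bar>) UNIV"
    by (simp add: norm_vec_def matrix_vector_mult_def inner_vec_def)
  also have "\<dots> \<le> L2_set (\<lambda>i. norm (M $ i) * norm x) UNIV"
    by (intro L2_set_mono) (auto simp: Cauchy_Schwarz_ineq2)
  also have "\<dots> = norm M * norm x"
    by (simp add: L2_set_left_distrib norm_vec_def[of M])
  finally show ?thesis .
qed

lemma norm_outer: "norm (outer u u) = u \<bullet> u"
proof -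
  have "outer u u $ i = u $ i *\<^sub>R u" for i by (simp add: outer_def vec_eq_iff)
  then have "norm (outer u u) = L2_set (\<lambda>i. norm (u $ i) * norm u) UNIV"
    by (simp add: norm_vec_def[of "outer u u"])
  also have "\<dots> = norm u * norm u"
    by (simp add: L2_set_left_distrib norm_vec_def[of u])
  finally show ?thesis by (simp add: norm_eq_sqrt_inner)
qed

lemma inner_matrix_outer: "M \<bullet> outer u u = u \<bullet> (M *v u)"
  by (simp add: inner_vec_def outer_def matrix_vector_mult_def sum_distrib_left mult_ac)

section \<open>Vectors as stacks of blocks\<close>

definition blk :: "real^('n::finite \<times> 'd::finite) \<Rightarrow> 'n \<Rightarrow> real^'d" where
  "blk x i = (\<chi> a. x $ (i, a))"

lemma blk_stack [simp]: "blk (stack t) i = t i"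
  by (simp add: blk_def stack_def vec_eq_iff)

lemma blk_diff: "blk (x - y) i = blk x i - blk y i"
  and blk_scaleR: "blk (c *\<^sub>R x) i = c *\<^sub>R blk x i"
  by (simp_all add: blk_def vec_eq_iff)

lemma blk_eqI: "(\<And>i. blk x i = blk y i) \<Longrightarrow> x = y"
  by (auto simp: blk_def vec_eq_iff)

lemma sum_prod_UNIV:
  "(\<Sum>p\<in>UNIV. f p) = (\<Sum>i\<in>UNIV. \<Sum>a\<in>UNIV. f (i, a))" for f :: "'n::finite \<times> 'd::finite \<Rightarrow> 'c::comm_monoid_add"
  by (simp add: sum.cartesian_product UNIV_Times_UNIV[symmetric] del: UNIV_Times_UNIV)

lemma inner_blk: "x \<bullet> y = (\<Sum>i\<in>UNIV. blk x i \<bullet> blk y i)"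
  by (simp add: inner_vec_def blk_def sum_prod_UNIV)

lemma blk_block_matrix: "blk (block_matrix B *v x) i = (\<Sum>j\<in>UNIV. B i j *v blk x j)"
  by (simp add: vec_eq_iff blk_def block_matrix_def matrix_vector_mult_def sum_prod_UNIV)

section \<open>Sums over oriented edges and quadratic forms of Laplacians\<close>

lemma oriented_edge:
  assumes "simple_graph E" "orientation A E" "(i, j) \<in> A"
  shows "{i, j} \<in> E" "i \<noteq> j"
proof -
  show "{i, j} \<in> E" using assms(2,3) by (force simp: orientation_def bij_betw_def)
  then show "i \<noteq> j" using assms(1) by (force simp: simple_graph_def)
qed

lemma edge_oriented:
  assumes "orientation A E" "{i, j} \<in> E"
  shows "(i, j) \<in> A \<or> (j, i) \<in> A"
proof -
  have "E = (\<lambda>(i, j). {i, j}) ` A" using assms(1) by (simp add: orientation_def bij_betw_def)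
  then obtain k l where "(k, l) \<in> A" "{k, l} = {i, j}" using assms(2) by auto
  then show ?thesis by (auto simp: doubleton_eq_iff)
qed

lemma card_orientation: "orientation A E \<Longrightarrow> card A = card E"
  unfolding orientation_def by (rule bij_betw_same_card)

text \<open>The ordered pairs of adjacent vertices are the disjoint union of \<open>A\<close> and
  its reversal: an edge has only one orientation in \<open>A\<close>, and there are no
  loops.\<close>

lemma oriented_edge_sum:
  fixes F :: "'n::finite \<Rightarrow> 'n \<Rightarrow> real"
  assumes E: "simple_graph E" and A: "orientation A E"
  shows "(\<Sum>i\<in>UNIV. \<Sum>j | {i, j} \<in> E. F i j) = (\<Sum>(i, j)\<in>A. F i j + F j i)"
proof -
  have "(\<Sum>i\<in>UNIV. \<Sum>j | {i, j} \<in> E. F i j) = (\<Sum>(i, j)\<in>(SIGMA i:UNIV. {j. {i, j} \<in> E}). F i j)"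
    by (simp add: sum.Sigma)
  also have "(SIGMA i:UNIV. {j. {i, j} \<in> E}) = A \<union> prod.swap ` A"
  proof
    show "A \<union> prod.swap ` A \<subseteq> (SIGMA i:UNIV. {j. {i, j} \<in> E})"
      using oriented_edge(1)[OF E A] by (auto simp: insert_commute)
    show "(SIGMA i:UNIV. {j. {i, j} \<in> E}) \<subseteq> A \<union> prod.swap ` A"
    proof
      fix p assume "p \<in> (SIGMA i:UNIV. {j. {i, j} \<in> E})"
      then obtain i j where ij: "p = (i, j)" "{i, j} \<in> E" by blast
      then show "p \<in> A \<union> prod.swap ` A" using edge_oriented[OF A ij(2)] by force
    qed
  qed
  also have "(\<Sum>(i, j)\<in>A \<union> prod.swap ` A. F i j) = (\<Sum>(i, j)\<in>A. F i j) + (\<Sum>(i, j)\<in>prod.swap ` A. F i j)"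
  proof (rule sum.union_disjoint)
    have "inj_on (\<lambda>(i, j). {i, j}) A" using A by (simp add: orientation_def bij_betw_def)
    then have "i = j" if "(i, j) \<in> A" "(j, i) \<in> A" for i j
      using that by (force simp: inj_on_def insert_commute)
    then show "A \<inter> prod.swap ` A = {}" using oriented_edge(2)[OF E A] by fastforce
  qed (auto intro: finite_subset[OF subset_UNIV])
  also have "(\<Sum>(i, j)\<in>prod.swap ` A. F i j) = (\<Sum>(i, j)\<in>A. F j i)"
    by (subst sum.reindex) (auto simp: case_prod_unfold)
  finally show ?thesis by (simp add: sum.distrib case_prod_unfold)
qed

lemma laplacian_mult:
  assumes "simple_graph E"
  shows "blk (laplacian E Q *v x) i = (\<Sum>j | {i, j} \<in> E. Q i j *v (blk x i - blk x j))"
proof -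
  have ne: "{i, i} \<notin> E" using assms by (force simp: simple_graph_def)
  have neg: "(- M) *v y = - (M *v y)" for M :: "real^'b^'b" and y
    by (simp add: matrix_vector_mult_def vec_eq_iff sum_negf)
  let ?B = "\<lambda>j. if i = j then (\<Sum>k | {i, k} \<in> E. Q i k) else if {i, j} \<in> E then - Q i j else 0"
  have "blk (laplacian E Q *v x) i = (\<Sum>j\<in>UNIV. ?B j *v blk x j)"
    by (simp add: laplacian_def blk_block_matrix)
  also have "\<dots> = ?B i *v blk x i + (\<Sum>j\<in>UNIV - {i}. ?B j *v blk x j)"
    by (rule sum.remove) auto
  also have "?B i *v blk x i = (\<Sum>j | {i, j} \<in> E. Q i j *v blk x i)"
    by (simp add: sum_matrix_vector_mult)
  also have "(\<Sum>j\<in>UNIV - {i}. ?B j *v blk x j) = (\<Sum>j | {i, j} \<in> E. - (Q i j *v blk x j))"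
    using ne neg by (intro sum.mono_neutral_cong_right) auto
  also have "(\<Sum>j | {i, j} \<in> E. Q i j *v blk x i) + (\<Sum>j | {i, j} \<in> E. - (Q i j *v blk x j))
      = (\<Sum>j | {i, j} \<in> E. Q i j *v (blk x i - blk x j))"
    by (simp add: sum.distrib[symmetric] matrix_vector_mult_diff_distrib)
  finally show ?thesis .
qed

text \<open>The two directions of an edge contribute x_i . Q (x_i - x_j) and x_j . Q (x_j - x_i)
  with the same Q; they add up to the form at the difference.\<close>

lemma laplacian_quadratic:
  assumes E: "simple_graph E" and A: "orientation A E"
    and Q: "\<And>i j. (i, j) \<in> A \<Longrightarrow> Q i j = Q j i"
  shows "x \<bullet> (laplacian E Q *v x)
    = (\<Sum>(i, j)\<in>A. (blk x i - blk x j) \<bullet> (Q i j *v (blk x i - blk x j)))"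
proof -
  have "x \<bullet> (laplacian E Q *v x)
      = (\<Sum>i\<in>UNIV. \<Sum>j | {i, j} \<in> E. blk x i \<bullet> (Q i j *v (blk x i - blk x j)))"
    by (simp add: inner_blk laplacian_mult[OF E] inner_sum_right)
  also have "\<dots> = (\<Sum>(i, j)\<in>A. (blk x i - blk x j) \<bullet> (Q i j *v (blk x i - blk x j)))"
    unfolding oriented_edge_sum[OF E A]
    by (intro sum.cong refl)
       (auto simp: Q[symmetric] inner_diff_left inner_diff_right matrix_vector_mult_diff_distrib)
  finally show ?thesis .
qed

lemma laplacian_symmetric:
  assumes E: "simple_graph E" and "\<And>i j. transpose (Q i j) = Q i j"
    and "\<And>i j. {i, j} \<in> E \<Longrightarrow> Q i j = Q j i"
  shows "transpose (laplacian E Q) = laplacian E Q"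
proof -
  have "Q i j $ a $ b = Q i j $ b $ a" for i j a b
  proof -
    have "transpose (Q i j) $ a $ b = Q i j $ a $ b" by (simp only: assms(2))
    then show ?thesis by (simp add: transpose_def)
  qed
  then show ?thesis
    using assms(3)
    by (auto simp: laplacian_def block_matrix_def transpose_def vec_eq_iff insert_commute)
qed

lemma graph_laplacian_symmetric: "transpose (graph_laplacian E) = graph_laplacian E"
  by (simp add: graph_laplacian_def degree_matrix_def adjacency_matrix_def transpose_def
      vec_eq_iff insert_commute)

lemma graph_laplacian_quadratic:
  assumes E: "simple_graph E" and A: "orientation A E"
  shows "u \<bullet> (graph_laplacian E *v u) = (\<Sum>(i, j)\<in>A. (u $ i - u $ j)\<^sup>2)"
proof -
  have "(graph_laplacian E *v u) $ i = (\<Sum>j | {i, j} \<in> E. u $ i - u $ j)" for i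
  proof -
    have "(graph_laplacian E *v u) $ i
        = (\<Sum>j\<in>UNIV. (if i = j then real (card {k. {i, k} \<in> E}) * u $ j else 0))
          - (\<Sum>j\<in>UNIV. if {i, j} \<in> E then u $ j else 0)"
      by (simp add: graph_laplacian_def degree_matrix_def adjacency_matrix_def
          matrix_vector_mult_def left_diff_distrib sum_subtractf if_distrib[of "\<lambda>x. x * _"] cong: if_cong)
    also have "\<dots> = (\<Sum>j | {i, j} \<in> E. u $ i - u $ j)"
      by (simp add: sum_subtractf sum.If_cases)
    finally show ?thesis .
  qed
  then have "u \<bullet> (graph_laplacian E *v u) = (\<Sum>i\<in>UNIV. \<Sum>j | {i, j} \<in> E. u $ i * (u $ i - u $ j))"
    by (simp add: inner_vec_def sum_distrib_left)
  also have "\<dots> = (\<Sum>(i, j)\<in>A. (u $ i - u $ j)\<^sup>2)"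
    unfolding oriented_edge_sum[OF E A] by (simp add: power2_eq_square algebra_simps)
  finally show ?thesis .
qed

text \<open>The constraint matrix is itself the block Laplacian of the graph with a single edge and
  weight \<open>mat 1\<close>.\<close>

lemma C_matrix_quadratic:
  assumes "i \<noteq> j"
  shows "x \<bullet> (C_matrix i j *v x) = (norm (blk x i - blk x j))\<^sup>2"
proof -
  have "C_matrix i j = laplacian {{i, j}} (\<lambda>_ _. mat 1 :: real^'b^'b)"
  proof -
    have "{l. {k, l} = {i, j}} = (if k = i then {j} else if k = j then {i} else {})" for k
      using assms by (auto simp: doubleton_eq_iff)
    then show ?thesis
      using assms by (auto simp: C_matrix_def laplacian_def doubleton_eq_iff intro!: arg_cong[of _ _ block_matrix] ext)
  qed
  moreover have "simple_graph {{i, j}}" "orientation {(i, j)} {{i, j}}"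
    using assms by (auto simp: simple_graph_def orientation_def bij_betw_def)
  ultimately show ?thesis
    by (simp add: laplacian_quadratic power2_norm_eq_inner)
qed

text \<open>Multiplication by \<open>H_matrix\<close> replaces every block by the sum of all blocks,
  so its trace constraint forces block sums to vanish.\<close>

lemma H_matrix_quadratic:
  fixes x :: "real^('n::finite \<times> 'd::finite)"
  shows "x \<bullet> (H_matrix *v x) = (norm (\<Sum>i\<in>UNIV. blk x i))\<^sup>2"
proof -
  have "blk (H_matrix *v x) i = (\<Sum>j\<in>UNIV. blk x j)" for i
    by (simp add: vec_eq_iff blk_def H_matrix_def kronecker_def mat_def matrix_vector_mult_def
        sum_prod_UNIV if_distrib[of "\<lambda>y. y * _"] cong: if_cong)
  then have "x \<bullet> (H_matrix *v x) = (\<Sum>i\<in>UNIV. blk x i \<bullet> (\<Sum>j\<in>UNIV. blk x j))"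
    by (simp only: inner_blk)
  then show ?thesis
    by (simp only: power2_norm_eq_inner inner_sum_left)
qed

section \<open>Spectral gap, rigidity and perturbation of lines\<close>

text \<open>The eigenvectors of value 0 form a basis of the null space, so its dimension counts the
  zeros among the eigenvalues. A vector orthogonal to it has components only along eigenvectors
  whose value is at least the first positive one.\<close>

lemma eigenvalue_gap:
  fixes A :: "real^'k::finite^'k"
  assumes es: "eigensystem A v \<mu>" and nn: "\<And>x. 0 \<le> x \<bullet> (A *v x)"
    and r: "dim {x. A *v x = 0} = r" "r < CARD('k)"
  shows "0 < eigenvalue (Suc r) A"
    and "(\<And>z. A *v z = 0 \<Longrightarrow> z \<bullet> y = 0) \<Longrightarrow> eigenvalue (Suc r) A * (y \<bullet> y) \<le> y \<bullet> (A *v y)"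
proof -
  have orth: "v i \<bullet> v j = (if i = j then 1 else 0)" and Av: "A *v v i = \<mu> i *\<^sub>R v i" for i j
    using es unfolding eigensystem_def by blast+
  have \<mu>: "0 \<le> \<mu> i" for i
    using nn[of "v i"] orth[of i i] by (simp add: Av)
  let ?Z = "{i. \<mu> i = 0}"
  have inj: "inj v"
  proof (rule injI)
    fix i j assume "v i = v j"
    then show "i = j" using orth[of i j] orth[of j j] by (auto split: if_splits)
  qed
  have "dim {x. A *v x = 0} = card ?Z"
  proof (rule dim_unique)
    show "v ` ?Z \<subseteq> {x. A *v x = 0}" by (auto simp: Av)
    show "{x. A *v x = 0} \<subseteq> span (v ` ?Z)"
    proof
      fix x assume "x \<in> {x. A *v x = 0}"
      then have "\<mu> i * (v i \<bullet> x) = 0" for i using eigensystem_symmetric[OF es, of i x] by simp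
      then have z: "\<mu> i = 0 \<or> v i \<bullet> x = 0" for i by simp
      have "(v i \<bullet> x) *\<^sub>R v i \<in> span (v ` ?Z)" for i
        using z[of i] by (auto intro: span_scale span_base span_zero)
      then have "(\<Sum>i\<in>UNIV. (v i \<bullet> x) *\<^sub>R v i) \<in> span (v ` ?Z)" by (intro span_sum)
      then show "x \<in> span (v ` ?Z)" by (subst eigensystem_expand[OF es])
    qed
    have "v i \<noteq> 0" for i using orth[of i i] by auto
    moreover have "pairwise orthogonal (v ` ?Z)"
      by (auto simp: pairwise_def orthogonal_def orth)
    ultimately show "independent (v ` ?Z)"
      by (intro pairwise_orthogonal_independent) force+
    show "card (v ` ?Z) = card ?Z" using inj by (intro card_image) (auto simp: inj_on_def)
  qed
  then have card: "card ?Z = r" using r(1) by simp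
  show "0 < eigenvalue (Suc r) A"
    by (rule eigenvalue_first_positive(1)[OF es \<mu> card r(2)])
  show "eigenvalue (Suc r) A * (y \<bullet> y) \<le> y \<bullet> (A *v y)"
    if null: "\<And>z. A *v z = 0 \<Longrightarrow> z \<bullet> y = 0"
  proof -
    have "eigenvalue (Suc r) A * (v i \<bullet> y)\<^sup>2 \<le> \<mu> i * (v i \<bullet> y)\<^sup>2" for i
    proof (cases "\<mu> i = 0")
      case True
      then show ?thesis using null[of "v i"] by (simp add: Av)
    next
      case False
      then show ?thesis
        by (intro mult_right_mono eigenvalue_first_positive(2)[OF es \<mu> card r(2)]) auto
    qed
    then have "(\<Sum>i\<in>UNIV. eigenvalue (Suc r) A * (v i \<bullet> y)\<^sup>2) \<le> (\<Sum>i\<in>UNIV. \<mu> i * (v i \<bullet> y)\<^sup>2)"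
      by (intro sum_mono)
    then show ?thesis
      by (simp add: eigensystem_quadratic[OF es] eigensystem_inner[OF es, of y y]
          sum_distrib_left power2_eq_square)
  qed
qed



text \<open>The linear form of rigidity, in which \<open>q\<close> may have coincident points. Since
  \<open>t\<close> is injective, each pair of vertices excludes at most one \<open>s\<close> for
  which t + s q makes them coincide. Some nonzero \<open>s\<close> avoids these finitely many
  values, rigidity applies to t + s q, and the result is solved for \<open>q\<close>.\<close>

lemma parallel_rigid_linear:
  fixes t q :: "'n::finite \<Rightarrow> real^'d::finite"
  assumes rigid: "parallel_rigid E t"
    and q: "\<And>i j. {i, j} \<in> E \<Longrightarrow> \<exists>s. q i - q j = s *\<^sub>R (t i - t j)"
  obtains c w where "\<And>i. q i = c *\<^sub>R t i + w"
proof -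
  have inj: "inj t" using rigid by (simp add: parallel_rigid_def)
  have "finite {s. t i - t j + s *\<^sub>R (q i - q j) = 0}" if "i \<noteq> j" for i j
  proof -
    have ne: "t i - t j \<noteq> 0" using inj that by (auto simp: inj_def)
    have "s = s'" if "t i - t j + s *\<^sub>R (q i - q j) = 0" "t i - t j + s' *\<^sub>R (q i - q j) = 0" for s s'
    proof -
      have "(s - s') *\<^sub>R (q i - q j)
          = (t i - t j + s *\<^sub>R (q i - q j)) - (t i - t j + s' *\<^sub>R (q i - q j))"
        by (simp add: scaleR_left_diff_distrib)
      also have "\<dots> = 0" using that by (simp only: diff_self)
      finally have "(s - s') *\<^sub>R (q i - q j) = 0" .
      moreover have "q i - q j \<noteq> 0" using that ne by auto
      ultimately show ?thesis by simp
    qed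
    then have "{s. t i - t j + s *\<^sub>R (q i - q j) = 0} = {}
        \<or> (\<exists>s. {s. t i - t j + s *\<^sub>R (q i - q j) = 0} = {s})"
      by blast
    then show ?thesis by (metis finite.emptyI finite.insertI)
  qed
  then have "finite (insert 0 (\<Union>(i, j)\<in>{(i, j). i \<noteq> j}. {s. t i - t j + s *\<^sub>R (q i - q j) = 0}))"
    by (auto intro: finite_subset[OF subset_UNIV])
  from ex_new_if_finite[OF infinite_UNIV_char_0 this] obtain s :: real where
    s: "s \<noteq> 0" "\<And>i j. i \<noteq> j \<Longrightarrow> t i - t j + s *\<^sub>R (q i - q j) \<noteq> 0"
    by blast
  define p where "p i = t i + s *\<^sub>R q i" for i
  have pd: "p i - p j = t i - t j + s *\<^sub>R (q i - q j)" for i j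
    by (simp add: p_def scaleR_diff_right)
  have "inj p"
  proof (rule injI)
    fix i j assume "p i = p j"
    then show "i = j" using s(2)[of i j] pd[of i j] by auto
  qed
  moreover have "\<exists>b. p i - p j = b *\<^sub>R (t i - t j)" if ij: "{i, j} \<in> E" for i j
  proof -
    obtain b where "q i - q j = b *\<^sub>R (t i - t j)" using q[OF ij] by blast
    then have "p i - p j = (1 + s * b) *\<^sub>R (t i - t j)" by (simp add: pd scaleR_add_left)
    then show ?thesis by blast
  qed
  ultimately obtain c w where cw: "\<And>i. p i = c *\<^sub>R t i + w"
    using rigid unfolding parallel_rigid_def by blast
  have "q i = ((c - 1) / s) *\<^sub>R t i + (1 / s) *\<^sub>R w" for i
  proof -
    have "s *\<^sub>R q i = (c - 1) *\<^sub>R t i + w" using cw[of i] by (simp add: p_def algebra_simps)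
    then have "(1 / s) *\<^sub>R (s *\<^sub>R q i) = (1 / s) *\<^sub>R ((c - 1) *\<^sub>R t i + w)" by simp
    then show ?thesis using s(1) by (simp add: scaleR_add_right)
  qed
  then show ?thesis by (rule that)
qed

section \<open>Distance of a vector to a line\<close>

lemma projection_quadratic:
  assumes "norm g = 1"
  shows "y \<bullet> ((mat 1 - outer g g) *v y) = (norm (y - (g \<bullet> y) *\<^sub>R g))\<^sup>2"
  using assms
  by (simp add: matrix_vector_mult_diff_rdistrib outer_mult_vector power2_norm_eq_inner
      inner_diff_left inner_diff_right inner_commute norm_eq_1)

lemma norm_projection_le_norm:
  assumes "norm g = 1"
  shows "norm (y - (g \<bullet> y) *\<^sub>R g) \<le> norm y"
proof (rule power2_le_imp_le)
  show "(norm (y - (g \<bullet> y) *\<^sub>R g))\<^sup>2 \<le> (norm y)\<^sup>2"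
    using assms
    by (simp only: power2_norm_eq_inner)
       (simp add: inner_diff_left inner_diff_right inner_commute norm_eq_1)
qed simp

text \<open>The left-hand side is the distance of \<open>y\<close> to the line spanned by \<open>g\<close>.\<close>

lemma norm_projection_perturb:
  assumes g: "norm g = 1" and h: "norm h = 1"
  shows "norm (y - (g \<bullet> y) *\<^sub>R g) \<le> norm (y - (h \<bullet> y) *\<^sub>R h) + norm (h - g) * norm y"
proof -
  \<comment> \<open>The coefficient g . y is the best one on the line of \<open>g\<close>; replacing
    it by h . y costs exactly the square of the difference, by Pythagoras.\<close>
  have "(norm (y - (g \<bullet> y) *\<^sub>R g))\<^sup>2 \<le> (norm (y - (h \<bullet> y) *\<^sub>R g))\<^sup>2"
  proof -
    have "(norm (y - (h \<bullet> y) *\<^sub>R g))\<^sup>2 - (norm (y - (g \<bullet> y) *\<^sub>R g))\<^sup>2 = (h \<bullet> y - g \<bullet> y)\<^sup>2"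
      using g by (simp add: power2_norm_eq_inner inner_diff_left inner_diff_right inner_commute
          norm_eq_1) (simp add: power2_eq_square algebra_simps inner_commute)
    then show ?thesis by (smt (verit) zero_le_power2)
  qed
  then have "norm (y - (g \<bullet> y) *\<^sub>R g) \<le> norm (y - (h \<bullet> y) *\<^sub>R g)"
    by (rule power2_le_imp_le) simp
  also have "y - (h \<bullet> y) *\<^sub>R g = (y - (h \<bullet> y) *\<^sub>R h) + (h \<bullet> y) *\<^sub>R (h - g)"
    by (simp add: algebra_simps)
  also have "norm \<dots> \<le> norm (y - (h \<bullet> y) *\<^sub>R h) + norm ((h \<bullet> y) *\<^sub>R (h - g))"
    by (rule norm_triangle_ineq)
  also have "norm ((h \<bullet> y) *\<^sub>R (h - g)) \<le> norm y * norm (h - g)"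
    using Cauchy_Schwarz_ineq2[of h y] h by (simp add: mult_right_mono)
  finally show ?thesis by (simp add: mult.commute)
qed

lemma norm_unit_dir: "inj t \<Longrightarrow> i \<noteq> j \<Longrightarrow> norm (unit_dir t i j) = 1"
  by (simp add: unit_dir_def inj_eq)

lemma outer_unit_dir_commute:
  "outer (unit_dir t i j) (unit_dir t i j) = outer (unit_dir t j i) (unit_dir t j i)"
proof -
  have "unit_dir t j i = - unit_dir t i j"
    by (simp add: unit_dir_def norm_minus_commute[of "t i"] scaleR_diff_right)
  then show ?thesis by (simp add: outer_def)
qed

lemma unit_dir_projection: "(unit_dir t i j \<bullet> (t i - t j)) *\<^sub>R unit_dir t i j = t i - t j"
proof (cases "t i = t j")
  case False
  then have "unit_dir t i j \<bullet> (t i - t j) = norm (t i - t j)"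
    by (simp add: unit_dir_def dot_square_norm power2_eq_square)
  then show ?thesis using False by (simp add: unit_dir_def)
qed (simp add: unit_dir_def)

text \<open>The form is a sum of squared distances to the lines of \<open>t\<close>. If it vanishes,
  every edge difference of \<open>x\<close> is parallel to that of \<open>t\<close>, and the linear
  form of rigidity applies.\<close>

lemma rigid_null_space:
  fixes t :: "'n::finite \<Rightarrow> real^'d::finite"
  assumes E: "simple_graph E" and A: "orientation A E" and rigid: "parallel_rigid E t"
    and L: "L = laplacian E (\<lambda>i j. mat 1 - outer (unit_dir t i j) (unit_dir t i j))"
  shows "L *v x = 0 \<longleftrightarrow> (\<exists>c w. \<forall>i. blk x i = c *\<^sub>R t i + w)"
proof
  have inj: "inj t" using rigid by (simp add: parallel_rigid_def)
  note unit = norm_unit_dir[OF inj] and sym = outer_unit_dir_commute[of t]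
  {
    assume "L *v x = 0"
    then have "x \<bullet> (L *v x) = 0" by simp
    then have "(\<Sum>(i, j)\<in>A. (blk x i - blk x j) \<bullet>
        ((mat 1 - outer (unit_dir t i j) (unit_dir t i j)) *v (blk x i - blk x j))) = 0"
      unfolding L by (subst (asm) laplacian_quadratic[OF E A]) (simp_all add: sym)
    then have "\<forall>p\<in>A. (case p of (i, j) \<Rightarrow> (blk x i - blk x j) \<bullet>
        ((mat 1 - outer (unit_dir t i j) (unit_dir t i j)) *v (blk x i - blk x j))) = 0"
      by (subst (asm) sum_nonneg_eq_0_iff)
         (auto intro: finite_subset[OF subset_UNIV] simp: projection_quadratic unit oriented_edge[OF E A])
    then have "norm (blk x i - blk x j - (unit_dir t i j \<bullet> (blk x i - blk x j)) *\<^sub>R unit_dir t i j) = 0"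
      if "(i, j) \<in> A" for i j
      using that projection_quadratic[OF unit, of i j] oriented_edge(2)[OF E A that] by auto
    then have *: "\<exists>s. blk x i - blk x j = s *\<^sub>R (t i - t j)" if "(i, j) \<in> A" for i j
      using that unfolding unit_dir_def norm_eq_zero eq_iff_diff_eq_0[symmetric] scaleR_scaleR by blast
    have "\<exists>s. blk x i - blk x j = s *\<^sub>R (t i - t j)" if "{i, j} \<in> E" for i j
    proof (cases "(i, j) \<in> A")
      case False
      then have "(j, i) \<in> A" using edge_oriented[OF A that] by blast
      then obtain s where "blk x j - blk x i = s *\<^sub>R (t j - t i)" using * by blast
      then have "blk x i - blk x j = s *\<^sub>R (t i - t j)" by (metis minus_diff_eq scaleR_minus_right)
      then show ?thesis by blast
    qed (rule *)
    then obtain c w where "\<And>i. blk x i = c *\<^sub>R t i + w"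
      using parallel_rigid_linear[OF rigid] by blast
    then show "\<exists>c w. \<forall>i. blk x i = c *\<^sub>R t i + w" by blast
  }
  assume "\<exists>c w. \<forall>i. blk x i = c *\<^sub>R t i + w"
  then obtain c w where cw: "\<And>i. blk x i = c *\<^sub>R t i + w" by blast
  have "(mat 1 - outer (unit_dir t i j) (unit_dir t i j)) *v (blk x i - blk x j) = 0" for i j
  proof -
    have "blk x i - blk x j = c *\<^sub>R (t i - t j)" by (simp add: cw scaleR_diff_right)
    then show ?thesis
      by (simp add: matrix_vector_mult_diff_rdistrib matrix_vector_mult_scaleR outer_mult_vector
          unit_dir_projection)
  qed
  then have "blk (L *v x) i = 0" for i by (simp add: L laplacian_mult[OF E])
  then show "L *v x = 0" by (intro blk_eqI) (simp add: blk_def vec_eq_iff)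
qed

text \<open>The space is spanned by \<open>stack t\<close> and the translations along the coordinate
  axes. Centring makes \<open>stack t\<close> orthogonal to all translations, so these d + 1 vectors
  are independent.\<close>

lemma dim_scalings_and_translations:
  fixes t :: "'n::finite \<Rightarrow> real^'d::finite"
  assumes t: "stack t \<noteq> 0" "(\<Sum>i\<in>UNIV. t i) = 0"
  shows "dim {x. \<exists>c w. \<forall>i. blk x i = c *\<^sub>R t i + w} = CARD('d) + 1"
proof (rule dim_unique)
  define e :: "'d \<Rightarrow> real^('n \<times> 'd)" where "e a = stack (\<lambda>_. axis a 1)" for a
  let ?V = "{x. \<exists>c w. \<forall>i. blk x i = c *\<^sub>R t i + w}" and ?B = "insert (stack t) (range e)"
  have ee: "e a \<bullet> e b = (if a = b then real CARD('n) else 0)" for a b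
    by (simp add: e_def inner_blk inner_axis_axis)
  have te: "stack t \<bullet> e a = 0" for a
    using t(2) by (simp add: e_def inner_blk inner_sum_left[symmetric])
  have e0: "e a \<noteq> 0" for a using ee[of a a] by auto
  show "?B \<subseteq> ?V"
  proof -
    have "\<exists>c w. \<forall>i. t i = c *\<^sub>R t i + w" by (rule exI[of _ 1], rule exI[of _ 0]) simp
    moreover have "\<exists>c w. \<forall>i. axis a 1 = c *\<^sub>R t i + w" for a
      by (rule exI[of _ 0], rule exI[of _ "axis a 1"]) simp
    ultimately show ?thesis by (auto simp: e_def)
  qed
  show "?V \<subseteq> span ?B"
  proof
    fix x assume "x \<in> ?V"
    then obtain c w where cw: "\<And>i. blk x i = c *\<^sub>R t i + w" by blast
    have "x = c *\<^sub>R stack t + (\<Sum>a\<in>UNIV. (w $ a) *\<^sub>R e a)"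
      using cw by (auto simp: vec_eq_iff blk_def stack_def e_def axis_def if_distrib cong: if_cong)
    also have "\<dots> \<in> span ?B"
      by (intro span_add span_scale span_sum span_base) auto
    finally show "x \<in> span ?B" .
  qed
  have "pairwise orthogonal ?B"
    by (auto simp: pairwise_def orthogonal_def te te[unfolded inner_commute[of "stack t"]] ee)
  then show "independent ?B"
    by (rule pairwise_orthogonal_independent) (use t(1) e0 in force)
  have "stack t \<notin> range e"
  proof
    assume "stack t \<in> range e"
    then obtain a where "stack t = e a" by blast
    then show False using te[of a] e0[of a] by simp
  qed
  moreover have "inj e"
  proof (rule injI)
    fix a b assume "e a = e b"
    then show "a = b" using ee[of a b] ee[of b b] by (auto split: if_splits)
  qed
  ultimately show "card ?B = CARD('d) + 1" by (simp add: card_image)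
qed

text \<open>Any nonnegative scale bounds the infimum. The scale 1 / Tr T is chosen because the
  Frobenius norm of a positive semidefinite matrix is at most its trace, so the scaled matrix has
  norm at most 1 and only the inner product with \<open>outer u u\<close> remains.\<close>

lemma err_le:
  fixes T :: "real^'k::finite^'k"
  assumes T: "psd T" "trace T > 0" and u: "u \<bullet> u = 1"
  shows "err T (outer u u) \<le> sqrt (2 * (trace T - u \<bullet> (T *v u)) / trace T)"
proof -
  obtain x :: "'k \<Rightarrow> real^'k" where x: "T = (\<Sum>k\<in>UNIV. outer (x k) (x k))"
    using psd_sum_outer[OF T(1)] by blast
  have "norm T \<le> (\<Sum>k\<in>UNIV. norm (outer (x k) (x k)))" unfolding x by (rule norm_sum)
  also have "\<dots> = trace T" by (simp add: x trace_sum trace_outer norm_outer)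
  finally have nT: "norm T \<le> trace T" .
  let ?c = "1 / trace T"
  have "(norm (?c *\<^sub>R T - outer u u))\<^sup>2 = (norm T / trace T)\<^sup>2 - 2 * ?c * (T \<bullet> outer u u) + (norm (outer u u))\<^sup>2"
    by (simp add: power2_norm_eq_inner inner_diff_left inner_diff_right inner_commute
        power_divide power2_eq_square[of "trace T"])
  also have "\<dots> \<le> 1 - 2 * ?c * (u \<bullet> (T *v u)) + 1"
    using nT T(2) by (simp add: inner_matrix_outer norm_outer u power_le_one)
  also have "\<dots> = 2 * (trace T - u \<bullet> (T *v u)) / trace T"
    using T(2) by (simp add: field_simps)
  finally have "norm (?c *\<^sub>R T - outer u u) \<le> sqrt (2 * (trace T - u \<bullet> (T *v u)) / trace T)"
    by (rule real_le_rsqrt)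
  moreover have "err T (outer u u) \<le> norm (?c *\<^sub>R T - outer u u)"
    unfolding err_def using T(2) by (intro cINF_lower bdd_belowI[of _ 0]) auto
  ultimately show ?thesis by simp
qed

text \<open>The edge energy splits over the coordinates of the blocks, and on each coordinate it is
  the form of the scalar graph Laplacian.\<close>

lemma edge_energy_le:
  fixes x :: "real^('n::finite \<times> 'd::finite)"
  assumes E: "simple_graph E" and A: "orientation A E"
  shows "(\<Sum>(i, j)\<in>A. (norm (blk x i - blk x j))\<^sup>2)
    \<le> eigenvalue CARD('n) (graph_laplacian E) * (x \<bullet> x)"
proof -
  let ?g = "eigenvalue CARD('n) (graph_laplacian E)"
  obtain v \<mu> where es: "eigensystem (graph_laplacian E) v \<mu>"
    using eigensystem_exists[OF graph_laplacian_symmetric] .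
  have quad: "u \<bullet> (graph_laplacian E *v u) \<le> ?g * (u \<bullet> u)" for u
    by (simp add: eigensystem_quadratic[OF es] eigensystem_inner[OF es, of u u] sum_distrib_left
        power2_eq_square[symmetric]) (intro sum_mono mult_right_mono eigenvalue_top[OF es], simp)
  define u where "u a = (\<chi> i. x $ (i, a))" for a
  have "(\<Sum>(i, j)\<in>A. (norm (blk x i - blk x j))\<^sup>2) = (\<Sum>(i, j)\<in>A. \<Sum>a\<in>UNIV. (u a $ i - u a $ j)\<^sup>2)"
    by (simp only: power2_norm_eq_inner inner_vec_def) (simp add: u_def blk_def power2_eq_square)
  also have "\<dots> = (\<Sum>a\<in>UNIV. u a \<bullet> (graph_laplacian E *v u a))"
    unfolding graph_laplacian_quadratic[OF E A] case_prod_unfold by (rule sum.swap)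
  also have "\<dots> \<le> (\<Sum>a\<in>UNIV. ?g * (u a \<bullet> u a))" by (intro sum_mono quad)
  also have "\<dots> = ?g * (x \<bullet> x)"
    unfolding sum_distrib_left[symmetric] inner_vec_def u_def sum_prod_UNIV
    by (subst sum.swap) simp
  finally show ?thesis .
qed

text \<open>Both bounds test the Laplacian on a unit eigenvector of the largest eigenvalue: each
  edge contributes (a - b)^2 <= 2 (a^2 + b^2) <= 2, and the length of the image is at most the
  Frobenius norm.\<close>

lemma graph_laplacian_top_bounds:
  fixes E :: "'n::finite set set"
  assumes E: "simple_graph E" and A: "orientation A E"
  shows "eigenvalue CARD('n) (graph_laplacian E) \<le> 2 * real (card E)"
    and "eigenvalue CARD('n) (graph_laplacian E) \<le> norm (graph_laplacian E)"
proof -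
  let ?L = "graph_laplacian E" and ?g = "eigenvalue CARD('n) (graph_laplacian E)"
  obtain v \<mu> where es: "eigensystem ?L v \<mu>"
    using eigensystem_exists[OF graph_laplacian_symmetric] .
  obtain k where k: "?g = \<mu> k" by (rule eigenvalue_attained[OF es, of "CARD('n)"]) (auto simp: Suc_leI)
  have v1: "v k \<bullet> v k = 1" and Lv: "?L *v v k = ?g *\<^sub>R v k"
    using es k by (auto simp: eigensystem_def)
  have "?g = v k \<bullet> (?L *v v k)" by (simp add: Lv v1)
  also have "\<dots> = (\<Sum>(i, j)\<in>A. (v k $ i - v k $ j)\<^sup>2)" by (rule graph_laplacian_quadratic[OF E A])
  also have "\<dots> \<le> (\<Sum>(i, j)\<in>A. 2)"
  proof (rule sum_mono, clarify)
    fix i j assume "(i, j) \<in> A"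
    then have "i \<noteq> j" using oriented_edge(2)[OF E A] by blast
    then have "(\<Sum>l\<in>{i, j}. (v k $ l)\<^sup>2) = (v k $ i)\<^sup>2 + (v k $ j)\<^sup>2" by simp
    moreover have "(\<Sum>l\<in>{i, j}. (v k $ l)\<^sup>2) \<le> (\<Sum>l\<in>UNIV. (v k $ l)\<^sup>2)" by (intro sum_mono2) auto
    moreover have "(\<Sum>l\<in>UNIV. (v k $ l)\<^sup>2) = 1" using v1 by (simp add: inner_vec_def power2_eq_square)
    ultimately have "(v k $ i)\<^sup>2 + (v k $ j)\<^sup>2 \<le> 1" by simp
    moreover have "(a - b)\<^sup>2 \<le> 2" if "a\<^sup>2 + b\<^sup>2 \<le> 1" for a b :: real
    proof -
      have "(a - b)\<^sup>2 \<le> (a - b)\<^sup>2 + (a + b)\<^sup>2" by simp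
      also have "\<dots> = 2 * (a\<^sup>2 + b\<^sup>2)" by (simp add: power2_eq_square algebra_simps)
      finally show ?thesis using that by simp
    qed
    ultimately show "(v k $ i - v k $ j)\<^sup>2 \<le> 2" by blast
  qed
  also have "\<dots> = 2 * real (card E)" by (simp add: card_orientation[OF A] case_prod_unfold)
  finally show "?g \<le> 2 * real (card E)" .
  have "norm (v k) = 1" using v1 by (simp add: norm_eq_1)
  then show "?g \<le> norm ?L" using norm_matrix_vector_le[of ?L "v k"] by (simp add: Lv)
qed

text \<open>Since \<alpha>_1 occurs both outside and inside the root, h (1 + y) is split as h / 2 +
  h (1 / 2 + y). The first part is at most \<alpha>_1 because g l <= 4 m^2. As 2 \<alpha>_2 = h^2 (K
  + 1), the second reduces to y^2 + y <= K + 1.\<close>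

lemma error_constant_bound:
  fixes g l m K K' :: real
  assumes "0 < l" "l \<le> g" "g \<le> 2 * m" "0 \<le> K'" "sqrt 2 * K' \<le> K"
  defines "\<alpha>\<^sub>1 \<equiv> sqrt 2 * m / l" and "\<alpha>\<^sub>2 \<equiv> (K + 1) * (g / l)"
  shows "sqrt (2 * g / l) * (1 + sqrt K') \<le> \<alpha>\<^sub>1 + sqrt (\<alpha>\<^sub>1\<^sup>2 + 2 * \<alpha>\<^sub>2)"
proof -
  define h y where "h = sqrt (2 * g / l)" and "y = sqrt K'"
  have h2: "h\<^sup>2 = 2 * g / l" and h0: "h \<ge> 0" and y2: "y\<^sup>2 = K'" and y0: "y \<ge> 0"
    using assms by (simp_all add: h_def y_def)
  have hsq: "(h / 2)\<^sup>2 = g * l / (2 * l\<^sup>2)"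
    using assms(1) by (simp add: power_divide h2) (simp add: field_simps power2_eq_square)
  have "g * l \<le> (2 * m) * (2 * m)" using assms by (intro mult_mono) auto
  then have "(h / 2)\<^sup>2 \<le> \<alpha>\<^sub>1\<^sup>2"
    unfolding hsq \<alpha>\<^sub>1_def using assms(1)
    by (simp add: power_divide power_mult_distrib field_simps power2_eq_square)
  moreover have a0: "0 \<le> \<alpha>\<^sub>1" using assms by (simp add: \<alpha>\<^sub>1_def)
  ultimately have ha: "h / 2 \<le> \<alpha>\<^sub>1" by (rule power2_le_imp_le)
  \<comment> \<open>A rational lower bound for sqrt 2 that still leaves (2 / 5) y^2 + 1 >=
    y.\<close>
  have "(7 / 5)\<^sup>2 \<le> (sqrt 2)\<^sup>2" by (simp add: power2_eq_square)
  then have "7 / 5 \<le> sqrt (2::real)" by (rule power2_le_imp_le) simp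
  then have "(7 / 5) * y\<^sup>2 \<le> sqrt 2 * y\<^sup>2" by (intro mult_right_mono) auto
  then have K: "(7 / 5) * y\<^sup>2 \<le> K" using assms(5) y2 by simp
  have "(1 / 2 + y)\<^sup>2 \<le> 1 / 4 + ((7 / 5) * y\<^sup>2 + 1)"
  proof -
    \<comment> \<open>5 / 4 is the minimiser of (2 / 5) y^2 - y.\<close>
    have "0 \<le> (y - 5 / 4)\<^sup>2" by simp
    then show ?thesis by (simp add: power2_eq_square algebra_simps)
  qed
  also have "\<dots> \<le> 1 / 4 + (K + 1)" using K by simp
  finally have "h\<^sup>2 * (1 / 2 + y)\<^sup>2 \<le> h\<^sup>2 * (1 / 4 + (K + 1))" by (intro mult_left_mono) auto
  also have "\<dots> = (h / 2)\<^sup>2 + 2 * \<alpha>\<^sub>2"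
    by (simp add: \<alpha>\<^sub>2_def power_divide h2 algebra_simps add_divide_distrib)
  also have "\<dots> \<le> \<alpha>\<^sub>1\<^sup>2 + 2 * \<alpha>\<^sub>2" using \<open>(h / 2)\<^sup>2 \<le> \<alpha>\<^sub>1\<^sup>2\<close> by simp
  finally have "h * (1 / 2 + y) \<le> sqrt (\<alpha>\<^sub>1\<^sup>2 + 2 * \<alpha>\<^sub>2)"
    by (intro real_le_rsqrt) (simp add: power_mult_distrib)
  then have "h / 2 + h * (1 / 2 + y) \<le> \<alpha>\<^sub>1 + sqrt (\<alpha>\<^sub>1\<^sup>2 + 2 * \<alpha>\<^sub>2)" using ha by simp
  then have "h * (1 + y) \<le> \<alpha>\<^sub>1 + sqrt (\<alpha>\<^sub>1\<^sup>2 + 2 * \<alpha>\<^sub>2)" by (simp add: algebra_simps)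
  then show ?thesis by (simp only: h_def y_def)
qed

section \<open>The error bound\<close>

lemma trace_mult_sum_outer:
  "trace (M ** (\<Sum>k\<in>S. outer (x k) (x k))) = (\<Sum>k\<in>S. x k \<bullet> (M *v x k))" for M :: "real^'k::finite^'k"
  by (simp add: matrix_mult_sum_right trace_sum trace_mult_outer)

lemma trace_mult_scaleR_outer: "trace (M ** (c *\<^sub>R outer u u)) = c * (u \<bullet> (M *v u))"
  using trace_mult_outer[of M u]
  by (simp add: trace_def matrix_matrix_mult_def mult.left_commute sum_distrib_left[symmetric])

theorem theorem2p3:
  fixes E :: "'n::finite set set"
    and A :: "('n \<times> 'n) set"
    and t :: "'n \<Rightarrow> real^'d::finite"
    and \<gamma> \<epsilon>v :: "'n \<Rightarrow> 'n \<Rightarrow> real^'d"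
    and \<Gamma> :: "'n \<Rightarrow> 'n \<Rightarrow> real^'d^'d"
    and \<epsilon> :: real
    and T :: "real^('n \<times> 'd)^('n \<times> 'd)"
  assumes "CARD('d) \<ge> 2" and "CARD('n) \<ge> 2"
    and "simple_graph E" and "orientation A E"
    and "generic_up_to_normalization t"
    and "trace (outer (stack t) (stack t)) = 1"
    and "trace (H_matrix ** outer (stack t) (stack t)) = 0"
    and "parallel_rigid E t"
    and "\<epsilon> \<ge> 0"
    and "\<And>i j. (i, j) \<in> A \<Longrightarrow> \<gamma> i j = unit_dir t i j + \<epsilon>v i j"
    and "\<And>i j. (i, j) \<in> A \<Longrightarrow> norm (\<epsilon>v i j) \<le> \<epsilon>"
    and "\<And>i j. (i, j) \<in> A \<Longrightarrow> norm (\<gamma> i j) = 1"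
    and "\<And>i j. (i, j) \<in> A \<Longrightarrow> \<Gamma> i j = outer (\<gamma> i j) (\<gamma> i j)"
    and "\<And>i j. {i, j} \<in> E \<Longrightarrow> \<Gamma> i j = \<Gamma> j i"
    and "sdp_solution E (laplacian E (\<lambda>i j. mat 1 - \<Gamma> i j)) T"
  shows
    "let d = CARD('d); n = CARD('n); m = real (card E);
         T\<^sub>0 = outer (stack t) (stack t);
         L\<^sub>0 = laplacian E (\<lambda>i j. mat 1 - outer (unit_dir t i j) (unit_dir t i j));
         L\<^sub>G = graph_laplacian E;
         \<kappa> = inverse (Min {(norm (t i - t j))\<^sup>2 | i j. {i, j} \<in> E});
         \<alpha>\<^sub>1 = sqrt 2 * m / eigenvalue (d + 2) L\<^sub>0;
         \<alpha>\<^sub>2 = (\<kappa> * sqrt (real d) * norm L\<^sub>G / m + 1) * (eigenvalue n L\<^sub>G / eigenvalue (d + 2) L\<^sub>0)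
     in err T T\<^sub>0 \<le> \<epsilon> * (\<alpha>\<^sub>1 + sqrt (\<alpha>\<^sub>1\<^sup>2 + 2 * \<alpha>\<^sub>2))"
proof -
  note E = assms(3) and A = assms(4) and rigid = assms(8) and eps = assms(9)
  let ?u = "stack t"
  define m where "m = real (card E)"
  define L\<^sub>0 where "L\<^sub>0 = laplacian E (\<lambda>i j. mat 1 - outer (unit_dir t i j) (unit_dir t i j))"
  define L where "L = laplacian E (\<lambda>i j. mat 1 - \<Gamma> i j)"
  define l where "l = eigenvalue (CARD('d) + 2) L\<^sub>0"
  define g where "g = eigenvalue CARD('n) (graph_laplacian E)"
  define \<kappa> where "\<kappa> = inverse (Min {(norm (t i - t j))\<^sup>2 | i j. {i, j} \<in> E})"
  define \<tau> where "\<tau> = trace T"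
  \<comment> \<open>For an oriented edge, \<open>p\<^sub>0\<close> and \<open>p\<close> are the
    distances of the block difference of \<open>x\<close> to the true and to the measured line, and
    \<open>e\<close> is its length.\<close>
  define p\<^sub>0 where "p\<^sub>0 x = (\<lambda>(i, j). let y = blk x i - blk x j in
    norm (y - (unit_dir t i j \<bullet> y) *\<^sub>R unit_dir t i j))" for x
  define p where "p x = (\<lambda>(i, j). let y = blk x i - blk x j in
    norm (y - (\<gamma> i j \<bullet> y) *\<^sub>R \<gamma> i j))" for x
  define e where "e x = (\<lambda>(i, j). norm (blk x i - blk x j))" for x :: "real^('n \<times> 'd)"
  have inj: "inj t" using rigid by (simp add: parallel_rigid_def)
  have unit: "norm (unit_dir t i j) = 1" if "(i, j) \<in> A" for i j
    using oriented_edge(2)[OF E A that] by (rule norm_unit_dir[OF inj])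

  have uu: "?u \<bullet> ?u = 1" using assms(6) by (simp add: trace_outer)
  have "(norm (\<Sum>i\<in>UNIV. t i))\<^sup>2 = 0"
    using assms(7) by (simp add: trace_mult_outer H_matrix_quadratic)
  then have sum0: "(\<Sum>i\<in>UNIV. t i) = 0" by simp

  note sym\<^sub>0 = outer_unit_dir_commute[of t]
  have L\<^sub>0_quad: "x \<bullet> (L\<^sub>0 *v x) = (\<Sum>a\<in>A. (p\<^sub>0 x a)\<^sup>2)" for x
    unfolding L\<^sub>0_def
    by (subst laplacian_quadratic[OF E A])
       (auto simp: sym\<^sub>0 p\<^sub>0_def Let_def projection_quadratic unit intro!: sum.cong)
  have \<Gamma>_sym: "mat 1 - \<Gamma> i j = mat 1 - \<Gamma> j i" if "(i, j) \<in> A" for i j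
    using assms(14)[OF oriented_edge(1)[OF E A that]] by simp
  have L_quad: "x \<bullet> (L *v x) = (\<Sum>a\<in>A. (p x a)\<^sup>2)" for x
    unfolding L_def
    by (subst laplacian_quadratic[OF E A \<Gamma>_sym])
       (auto simp: p_def Let_def assms(13) projection_quadratic assms(12) intro!: sum.cong)
  have energy: "(\<Sum>a\<in>A. (e x a)\<^sup>2) \<le> g * (x \<bullet> x)" for x
    using edge_energy_le[OF E A, of x] by (simp add: e_def g_def case_prod_unfold)
  have dir: "norm (\<gamma> i j - unit_dir t i j) \<le> \<epsilon>" if "(i, j) \<in> A" for i j
    using assms(10,11)[OF that] by simp
  \<comment> \<open>Both directions are used: the first carries the optimum from the measured to the
    true lines, the second bounds the objective at the true locations.\<close>
  have p\<^sub>0_le: "p\<^sub>0 x a \<le> p x a + \<epsilon> * e x a" and p_le: "p x a \<le> p\<^sub>0 x a + \<epsilon> * e x a"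
    if a: "a \<in> A" for x a
  proof -
    obtain i j where ij: "a = (i, j)" "(i, j) \<in> A" using a by (cases a) auto
    let ?y = "blk x i - blk x j"
    have d: "norm (\<gamma> i j - unit_dir t i j) * norm ?y \<le> \<epsilon> * norm ?y"
      by (intro mult_right_mono dir ij(2)) simp
    show "p\<^sub>0 x a \<le> p x a + \<epsilon> * e x a"
      using norm_projection_perturb[OF unit[OF ij(2)] assms(12)[OF ij(2)], of ?y] d
      by (simp add: ij(1) p\<^sub>0_def p_def e_def Let_def)
    show "p x a \<le> p\<^sub>0 x a + \<epsilon> * e x a"
      using norm_projection_perturb[OF assms(12)[OF ij(2)] unit[OF ij(2)], of ?y] d
      by (simp add: ij(1) p\<^sub>0_def p_def e_def Let_def norm_minus_commute)
  qed
  have p_nonneg: "0 \<le> p\<^sub>0 x a" "0 \<le> p x a" "0 \<le> e x a" for x a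
    by (cases a; simp add: p\<^sub>0_def p_def e_def Let_def)+

  have L\<^sub>0_sym: "transpose L\<^sub>0 = L\<^sub>0"
    unfolding L\<^sub>0_def
  proof (rule laplacian_symmetric[OF E])
    show "transpose (mat 1 - outer (unit_dir t i j) (unit_dir t i j))
        = mat 1 - outer (unit_dir t i j) (unit_dir t i j)" for i j
      by (simp add: transpose_def outer_def mat_def vec_eq_iff mult.commute)
  qed (simp add: sym\<^sub>0)
  obtain v \<mu> where es: "eigensystem L\<^sub>0 v \<mu>" using eigensystem_exists[OF L\<^sub>0_sym] .
  have L\<^sub>0_nonneg: "0 \<le> x \<bullet> (L\<^sub>0 *v x)" for x by (simp add: L\<^sub>0_quad sum_nonneg)
  have null: "L\<^sub>0 *v x = 0 \<longleftrightarrow> (\<exists>c w. \<forall>i. blk x i = c *\<^sub>R t i + w)" for x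
    by (rule rigid_null_space[OF E A rigid L\<^sub>0_def])
  have "?u \<noteq> 0" using uu by auto
  then have dim: "dim {x. L\<^sub>0 *v x = 0} = CARD('d) + 1"
    unfolding null using sum0 by (rule dim_scalings_and_translations)
  have card: "CARD('d) + 1 < CARD('n \<times> 'd)"
  proof -
    have "2 * CARD('d) \<le> CARD('n) * CARD('d)" using assms(2) by (rule mult_right_mono) simp
    moreover have "CARD('n \<times> 'd) = CARD('n) * CARD('d)" by simp
    ultimately show ?thesis using assms(1) by linarith
  qed
  \<comment> \<open>A null space of dimension d + 1 puts the first positive eigenvalue at index d +
    2, which exists since nd >= 2d > d + 1.\<close>
  have l_pos: "0 < l"
    using eigenvalue_gap(1)[OF es L\<^sub>0_nonneg dim card] by (simp add: l_def)
  have gap: "l * (x \<bullet> x - (?u \<bullet> x)\<^sup>2) \<le> x \<bullet> (L\<^sub>0 *v x)" if x: "(\<Sum>i\<in>UNIV. blk x i) = 0" for x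
  proof -
    \<comment> \<open>Removing the component along \<open>stack t\<close> leaves a centred vector
      orthogonal to all scalings and translations, without changing the form because
      \<open>stack t\<close> is a null vector.\<close>
    define y where "y = x - (?u \<bullet> x) *\<^sub>R ?u"
    have L\<^sub>0u: "L\<^sub>0 *v ?u = 0"
      unfolding null by (rule exI[of _ 1], rule exI[of _ 0]) simp
    have uy: "?u \<bullet> y = 0" by (simp add: y_def inner_diff_right uu)
    have ysum: "(\<Sum>i\<in>UNIV. blk y i) = 0"
      by (simp add: y_def blk_diff blk_scaleR sum_subtractf x scaleR_sum_right[symmetric] sum0)
    have "z \<bullet> y = 0" if "L\<^sub>0 *v z = 0" for z
    proof -
      obtain c w where cw: "\<And>i. blk z i = c *\<^sub>R t i + w" using \<open>L\<^sub>0 *v z = 0\<close> unfolding null by blast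
      have "z \<bullet> y = c * (?u \<bullet> y) + w \<bullet> (\<Sum>i\<in>UNIV. blk y i)"
        by (simp add: inner_blk cw inner_add_left sum.distrib sum_distrib_left inner_sum_right)
      then show ?thesis by (simp add: uy ysum)
    qed
    then have "l * (y \<bullet> y) \<le> y \<bullet> (L\<^sub>0 *v y)"
      using eigenvalue_gap(2)[OF es L\<^sub>0_nonneg dim card] by (simp add: l_def)
    moreover have "y \<bullet> y = x \<bullet> x - (?u \<bullet> x)\<^sup>2"
      by (simp add: y_def inner_diff_left inner_diff_right uu inner_commute power2_eq_square)
    moreover have "y \<bullet> (L\<^sub>0 *v y) = x \<bullet> (L\<^sub>0 *v x)"
    proof -
      have "L\<^sub>0 *v y = L\<^sub>0 *v x"
        by (simp add: y_def matrix_vector_mult_diff_distrib matrix_vector_mult_scaleR L\<^sub>0u)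
      moreover have "?u \<bullet> (L\<^sub>0 *v x) = 0"
        by (metis L\<^sub>0_sym L\<^sub>0u dot_lmul_matrix inner_zero_left transpose_matrix_vector)
      ultimately show ?thesis by (simp add: y_def inner_diff_left)
    qed
    ultimately show ?thesis by simp
  qed

  \<comment> \<open>Distance to a line is at most length, so the form of \<open>L\<^sub>0\<close> is
    at most the edge energy; this is tested on a unit eigenvector for \<open>l\<close>.\<close>
  have "l \<le> g"
  proof -
    obtain k where k: "l = \<mu> k"
      unfolding l_def using card by (auto intro: eigenvalue_attained[OF es, of "CARD('d) + 2"])
    have v1: "v k \<bullet> v k = 1" and Lv: "L\<^sub>0 *v v k = l *\<^sub>R v k"
      using es k unfolding eigensystem_def by metis+
    have "l = (\<Sum>a\<in>A. (p\<^sub>0 (v k) a)\<^sup>2)" by (simp add: L\<^sub>0_quad[symmetric] Lv v1)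
    also have "\<dots> \<le> (\<Sum>a\<in>A. (e (v k) a)\<^sup>2)"
      by (intro sum_mono power_mono p_nonneg)
         (auto simp: p\<^sub>0_def e_def Let_def norm_projection_le_norm unit)
    also have "\<dots> \<le> g" using energy[of "v k"] by (simp add: v1)
    finally show ?thesis .
  qed
  have g_bounds: "g \<le> 2 * m" "g \<le> norm (graph_laplacian E)"
    using graph_laplacian_top_bounds[OF E A] by (simp_all add: g_def m_def)
  \<comment> \<open>That there is at least one edge is a consequence of 0 < l <= g <= 2 m.\<close>
  have pos: "0 < g" "0 < m" using l_pos \<open>l \<le> g\<close> g_bounds(1) by linarith+

  let ?D = "{(norm (t i - t j))\<^sup>2 | i j. {i, j} \<in> E}"
  have finD: "finite ?D"
    by (rule finite_subset[of _ "range (\<lambda>(i, j). (norm (t i - t j))\<^sup>2)"]) auto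
  obtain i j where "(i, j) \<in> A"
    using pos(2) card_orientation[OF A] by (metis card.empty ex_in_conv m_def of_nat_0 order.irrefl surj_pair)
  then have "?D \<noteq> {}" using oriented_edge(1)[OF E A] by blast
  then have "Min ?D \<in> ?D" using finD by (rule Min_in[rotated])
  then obtain i j where "{i, j} \<in> E" "Min ?D = (norm (t i - t j))\<^sup>2" by blast
  moreover from this have "i \<noteq> j" using E by (force simp: simple_graph_def)
  ultimately have "0 < Min ?D" using inj by (simp add: inj_eq)
  then have \<kappa>_pos: "0 < \<kappa>" by (simp add: \<kappa>_def)
  have \<kappa>: "1 \<le> \<kappa> * (norm (t i - t j))\<^sup>2" if "{i, j} \<in> E" for i j
  proof -
    have "Min ?D \<le> (norm (t i - t j))\<^sup>2" using finD that by (intro Min_le) auto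
    then show ?thesis using \<open>0 < Min ?D\<close> by (simp add: \<kappa>_def field_simps)
  qed

  have feas: "feasible E T" and opt: "\<And>S. feasible E S \<Longrightarrow> trace (L ** T) \<le> trace (L ** S)"
    using assms(15) by (auto simp: sdp_solution_def is_arg_min_def L_def not_less)
  have T_psd: "psd T" using feas by (simp add: feasible_def)
  then obtain x :: "'n \<times> 'd \<Rightarrow> real^('n \<times> 'd)" where T: "T = (\<Sum>k\<in>UNIV. outer (x k) (x k))"
    by (rule psd_sum_outer)
  \<comment> \<open>A vanishing sum of squares centres each \<open>x k\<close> separately, which is
    the condition under which \<open>gap\<close> applies.\<close>
  have "(\<Sum>k\<in>UNIV. (norm (\<Sum>i\<in>UNIV. blk (x k) i))\<^sup>2) = 0"
    using feas by (simp add: feasible_def T trace_mult_sum_outer H_matrix_quadratic)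
  then have x0: "(\<Sum>i\<in>UNIV. blk (x k) i) = 0" for k by (cases k) (simp add: sum_nonneg_eq_0_iff)
  have \<tau>: "\<tau> = (\<Sum>k\<in>UNIV. x k \<bullet> x k)" by (simp add: \<tau>_def T trace_sum trace_outer)

  have MS: "(\<Sum>k\<in>UNIV. \<Sum>a\<in>A. (e (x k) a)\<^sup>2) \<le> g * \<tau>"
    unfolding \<tau> sum_distrib_left by (intro sum_mono energy)
  \<comment> \<open>The constraints bound the trace from below: each edge has total squared length
    at least 1, and the total energy is at most g \<tau>.\<close>
  have "m = (\<Sum>a\<in>A. 1)" by (simp add: m_def card_orientation[OF A])
  also have "\<dots> \<le> (\<Sum>(i, j)\<in>A. trace (C_matrix i j ** T))"
    using feas oriented_edge(1)[OF E A] by (intro sum_mono) (auto simp: feasible_def)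
  also have "\<dots> = (\<Sum>a\<in>A. \<Sum>k\<in>UNIV. (e (x k) a)\<^sup>2)"
    using oriented_edge(2)[OF E A]
    by (intro sum.cong) (auto simp: T trace_mult_sum_outer C_matrix_quadratic e_def)
  also have "\<dots> \<le> g * \<tau>" using MS by (subst sum.swap)
  finally have m_le: "m \<le> g * \<tau>" .
  then have \<tau>_pos: "0 < \<tau>" using pos by (smt (verit) zero_less_mult_pos)

  \<comment> \<open>Chosen so that m K' = \<kappa> g; then m <= g \<tau> turns the objective bound
    \<epsilon>^2 \<kappa> g into \<epsilon>^2 g \<tau> K'.\<close>
  define K' where "K' = \<kappa> * g / m"
  have K'_pos: "0 < K'" using \<kappa>_pos pos by (simp add: K'_def)
  have noisy: "(\<Sum>k\<in>UNIV. \<Sum>a\<in>A. (p (x k) a)\<^sup>2) \<le> \<epsilon>\<^sup>2 * (g * \<tau> * K')"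
  proof -
    have "feasible E (\<kappa> *\<^sub>R outer ?u ?u)"
      unfolding feasible_def
    proof (intro conjI allI impI)
      fix i j assume ij: "{i, j} \<in> E"
      then have "i \<noteq> j" using E by (force simp: simple_graph_def)
      then show "1 \<le> trace (C_matrix i j ** (\<kappa> *\<^sub>R outer ?u ?u))"
        using \<kappa>[OF ij] by (simp add: trace_mult_scaleR_outer C_matrix_quadratic)
    next
      show "trace (H_matrix ** (\<kappa> *\<^sub>R outer ?u ?u)) = 0"
        by (simp add: trace_mult_scaleR_outer H_matrix_quadratic sum0)
      show "psd (\<kappa> *\<^sub>R outer ?u ?u)" using \<kappa>_pos by (intro psd_scaleR_outer) simp
    qed
    then have "trace (L ** T) \<le> trace (L ** (\<kappa> *\<^sub>R outer ?u ?u))" by (rule opt)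
    then have "(\<Sum>k\<in>UNIV. \<Sum>a\<in>A. (p (x k) a)\<^sup>2) \<le> \<kappa> * (\<Sum>a\<in>A. (p ?u a)\<^sup>2)"
      by (simp add: T trace_mult_sum_outer trace_mult_scaleR_outer L_quad)
    also have "\<dots> \<le> \<kappa> * (\<Sum>a\<in>A. (\<epsilon> * e ?u a)\<^sup>2)"
    proof (intro mult_left_mono sum_mono power_mono)
      fix a assume a: "a \<in> A"
      obtain i j where ij: "a = (i, j)" by (cases a)
      \<comment> \<open>The true differences lie on the true lines, so at the reference point only
        the perturbation remains.\<close>
      have "p\<^sub>0 ?u a = 0" by (simp add: ij p\<^sub>0_def Let_def unit_dir_projection)
      then show "p ?u a \<le> \<epsilon> * e ?u a" using p_le[OF a, of ?u] by simp
    qed (use \<kappa>_pos p_nonneg in auto)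
    also have "\<dots> = \<kappa> * \<epsilon>\<^sup>2 * (\<Sum>a\<in>A. (e ?u a)\<^sup>2)"
      by (simp add: power_mult_distrib sum_distrib_left mult.assoc)
    also have "\<dots> \<le> \<kappa> * \<epsilon>\<^sup>2 * g"
      using energy[of ?u] \<kappa>_pos by (intro mult_left_mono) (auto simp: uu)
    also have "\<dots> = \<epsilon>\<^sup>2 * (m * K')" using pos by (simp add: K'_def)
    also have "\<dots> \<le> \<epsilon>\<^sup>2 * (g * \<tau> * K')"
      using m_le K'_pos by (intro mult_left_mono mult_right_mono) auto
    finally show ?thesis .
  qed

  define M\<^sub>0 where "M\<^sub>0 = (\<Sum>k\<in>UNIV. x k \<bullet> (L\<^sub>0 *v x k))"
  have M\<^sub>0: "sqrt M\<^sub>0 \<le> \<epsilon> * (sqrt (g * \<tau>) * (1 + sqrt K'))"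
  proof -
    \<comment> \<open>Minkowski is applied once, to functions of the pair of a rank-one term and an
      edge.\<close>
    let ?I = "(UNIV :: ('n \<times> 'd) set) \<times> A"
    have "sqrt M\<^sub>0 = L2_set (\<lambda>(k, a). p\<^sub>0 (x k) a) ?I"
      by (simp add: M\<^sub>0_def L\<^sub>0_quad L2_set_def sum.cartesian_product case_prod_unfold)
    also have "\<dots> \<le> L2_set (\<lambda>(k, a). p (x k) a + \<epsilon> * e (x k) a) ?I"
      using p\<^sub>0_le p_nonneg by (intro L2_set_mono) auto
    also have "\<dots> \<le> L2_set (\<lambda>(k, a). p (x k) a) ?I + L2_set (\<lambda>(k, a). \<epsilon> * e (x k) a) ?I"
      using L2_set_triangle_ineq[of "\<lambda>(k, a). p (x k) a" "\<lambda>(k, a). \<epsilon> * e (x k) a" ?I]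
      by (simp add: case_prod_unfold)
    also have "L2_set (\<lambda>(k, a). p (x k) a) ?I = sqrt (\<Sum>k\<in>UNIV. \<Sum>a\<in>A. (p (x k) a)\<^sup>2)"
      by (simp add: L2_set_def sum.cartesian_product case_prod_unfold)
    also have "\<dots> \<le> sqrt (\<epsilon>\<^sup>2 * (g * \<tau> * K'))" using noisy by (rule real_sqrt_le_mono)
    also have "\<dots> = \<epsilon> * (sqrt (g * \<tau>) * sqrt K')" using eps by (simp add: real_sqrt_mult)
    also have "L2_set (\<lambda>(k, a). \<epsilon> * e (x k) a) ?I = \<epsilon> * sqrt (\<Sum>k\<in>UNIV. \<Sum>a\<in>A. (e (x k) a)\<^sup>2)"
      using L2_set_right_distrib[OF eps, of "\<lambda>(k, a). e (x k) a" ?I]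
      by (simp add: L2_set_def sum.cartesian_product case_prod_unfold)
    also have "\<dots> \<le> \<epsilon> * sqrt (g * \<tau>)" using MS eps by (intro mult_left_mono real_sqrt_le_mono)
    finally show ?thesis by (simp add: algebra_simps)
  qed
  have r: "?u \<bullet> (T *v ?u) = (\<Sum>k\<in>UNIV. (?u \<bullet> x k)\<^sup>2)"
    by (simp add: T sum_matrix_vector_mult outer_mult_vector inner_sum_right power2_eq_square
        inner_commute)
  \<comment> \<open>By \<open>r\<close>, the bracket is the total squared distance of the
    \<open>x k\<close> to the line of \<open>stack t\<close>; \<open>gap\<close> is summed over
    \<open>k\<close>.\<close>
  have "l * (\<tau> - ?u \<bullet> (T *v ?u)) \<le> M\<^sub>0"
    unfolding M\<^sub>0_def \<tau> r sum_subtractf[symmetric] sum_distrib_left by (intro sum_mono gap x0)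
  then have "\<tau> - ?u \<bullet> (T *v ?u) \<le> M\<^sub>0 / l" using l_pos by (simp add: field_simps)
  then have "2 * (\<tau> - ?u \<bullet> (T *v ?u)) / \<tau> \<le> 2 * (M\<^sub>0 / l) / \<tau>"
    using \<tau>_pos by (intro divide_right_mono mult_left_mono) auto
  also have "\<dots> = 2 * M\<^sub>0 / (l * \<tau>)" by simp
  finally have "err T (outer ?u ?u) \<le> sqrt (2 * M\<^sub>0 / (l * \<tau>))"
    using err_le[OF T_psd _ uu] \<tau>_pos unfolding \<tau>_def[symmetric]
    by (meson order_trans real_sqrt_le_mono)
  also have "\<dots> = sqrt (2 / (l * \<tau>)) * sqrt M\<^sub>0" by (simp add: real_sqrt_mult[symmetric])
  also have "\<dots> \<le> sqrt (2 / (l * \<tau>)) * (\<epsilon> * (sqrt (g * \<tau>) * (1 + sqrt K')))"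
    using M\<^sub>0 l_pos \<tau>_pos by (intro mult_left_mono) auto
  also have "\<dots> = \<epsilon> * ((sqrt (2 / (l * \<tau>)) * sqrt (g * \<tau>)) * (1 + sqrt K'))" by simp
  \<comment> \<open>The unknown trace of the optimum cancels here.\<close>
  also have "sqrt (2 / (l * \<tau>)) * sqrt (g * \<tau>) = sqrt (2 * g / l)"
    using \<tau>_pos by (simp add: real_sqrt_mult[symmetric])
  finally have err: "err T (outer ?u ?u) \<le> \<epsilon> * (sqrt (2 * g / l) * (1 + sqrt K'))" .

  define K where "K = \<kappa> * sqrt (real CARD('d)) * norm (graph_laplacian E) / m"
  \<comment> \<open>The factor sqrt 2 is gained from d >= 2, while g is replaced by the larger
    Frobenius norm.\<close>
  have "sqrt 2 * K' \<le> K"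
  proof -
    have "sqrt 2 * g \<le> sqrt (real CARD('d)) * norm (graph_laplacian E)"
      using assms(1) g_bounds(2) pos by (intro mult_mono) auto
    then have "\<kappa> * (sqrt 2 * g) / m \<le> \<kappa> * (sqrt (real CARD('d)) * norm (graph_laplacian E)) / m"
      using \<kappa>_pos pos by (intro divide_right_mono mult_left_mono) auto
    then show ?thesis by (simp add: K_def K'_def mult_ac)
  qed
  from error_constant_bound[OF l_pos \<open>l \<le> g\<close> g_bounds(1) _ this] K'_pos
  have "sqrt (2 * g / l) * (1 + sqrt K')
      \<le> sqrt 2 * m / l + sqrt ((sqrt 2 * m / l)\<^sup>2 + 2 * ((K + 1) * (g / l)))"
    by simp
  from order_trans[OF err mult_left_mono[OF this eps]] show ?thesis
    by (simp only: Let_def K_def l_def g_def m_def \<kappa>_def L\<^sub>0_def)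
qed

end
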